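(* The even Weyl group $W^+(C_2^{++})$ of the hyperbolic Kac--Moody algebra $C_2^{++}$ is an index 2 extension of $PSL_2(\mathbb{Z}[i])$, that is, $$W^+(C_2^{++})\cong PSL_2(\mathbb{Z}[i])\rtimes 2,$$ where $\mathbb{Z}[i]$ is the ring of Gaussian integers.
   Context: For a Kac--Moody algebra with Cartan matrix $[A_{IJ}]$, the Weyl group $W$ is the Coxeter group with generators $w_I$ and relations $w_I^2=1$, $(w_Iw_J)^{m_{IJ}}=1$ for $I\ne J$, where $m_{IJ}=2,3,4,6,\infty$ according as $A_{IJ}A_{JI}=0,1,2,3,\ge4$. $W^+\subset W$ is the index 2 subgroup of products of an even number of generators. $C_2^{++}$ is the over-extension of $C_2$ (the untwisted affine extension with one more node attached by a single line to the affine node). Its nodes are $-1,0,1,2$, with $m_{-1,0}=3$, $m_{0,1}=4$, $m_{1,2}=4$, and $m_{IJ}=2$ for all other pairs of distinct nodes. $PSL_2(\mathbb{Z}[i])=SL_2(\mathbb{Z}[i])/\{\pm1\}$. The notation $A\rtimes 2$ means a semi-direct product of $A$ with $\mathbb{Z}/2\mathbb{Z}$: a group with a normal subgroup isomorphic to $A$ of index 2 and a complementary subgroup of order 2, acting on $A$ by conjugation as automorphisms. *)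

theory Defs
  imports
    "HOL-Algebra.Coset"
    "HOL-Analysis.Determinants"
    "HOL-Library.Extended_Nat"
begin

section \<open>Groups given by generators and relations\<close>

text \<open>A word in the generators \<open>S\<close> and their formal inverses: the letter \<open>(s, True)\<close> stands for
  \<open>s\<close> and \<open>(s, False)\<close> for the inverse of \<open>s\<close>.\<close>

type_synonym 'i gword = "('i \<times> bool) list"

definition gwords :: "'i set \<Rightarrow> 'i gword set" where
  "gwords S = lists (S \<times> UNIV)"

text \<open>The least congruence on words that makes \<open>s\<close> and its formal inverse cancel and
  trivialises every relator in \<open>R\<close>.\<close>

inductive pres_eq :: "'i set \<Rightarrow> 'i gword set \<Rightarrow> 'i gword \<Rightarrow> 'i gword \<Rightarrow> bool"
  for S R where
  refl: "u \<in> gwords S \<Longrightarrow> pres_eq S R u u"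
| sym: "pres_eq S R u v \<Longrightarrow> pres_eq S R v u"
| trans: "pres_eq S R u v \<Longrightarrow> pres_eq S R v w \<Longrightarrow> pres_eq S R u w"
| append: "pres_eq S R u u' \<Longrightarrow> pres_eq S R v v' \<Longrightarrow> pres_eq S R (u @ v) (u' @ v')"
| cancel: "s \<in> S \<Longrightarrow> pres_eq S R [(s, b), (s, \<not> b)] []"
| relator: "r \<in> R \<Longrightarrow> r \<in> gwords S \<Longrightarrow> pres_eq S R r []"

definition pres_class :: "'i set \<Rightarrow> 'i gword set \<Rightarrow> 'i gword \<Rightarrow> 'i gword set" where
  "pres_class S R u = {v. pres_eq S R u v}"

definition presented_group :: "'i set \<Rightarrow> 'i gword set \<Rightarrow> 'i gword set monoid" where
  "presented_group S R =
    \<lparr>carrier = pres_class S R ` gwords S,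
     monoid.mult = (\<lambda>U V. \<Union>u\<in>U. \<Union>v\<in>V. pres_class S R (u @ v)),
     one = pres_class S R []\<rparr>"

lemma pres_eq_gwords: "pres_eq S R u v \<Longrightarrow> u \<in> gwords S \<and> v \<in> gwords S"
  by (induction rule: pres_eq.induct) (auto simp: gwords_def)

lemma pres_class_eq_iff:
  assumes "u \<in> gwords S"
  shows "pres_class S R u = pres_class S R v \<longleftrightarrow> pres_eq S R u v"
  using assms unfolding pres_class_def
  by (auto intro: pres_eq.refl pres_eq.sym pres_eq.trans)

lemma presented_group_mult:
  assumes "u \<in> gwords S" "v \<in> gwords S"
  shows "pres_class S R u \<otimes>\<^bsub>presented_group S R\<^esub> pres_class S R v = pres_class S R (u @ v)"
proof -
  have "pres_class S R (u' @ v') = pres_class S R (u @ v)"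
    if "pres_eq S R u u'" "pres_eq S R v v'" for u' v'
    using pres_eq.append[OF that] assms
    by (subst eq_commute) (simp add: pres_class_eq_iff gwords_def)
  then have "(\<Union>u'\<in>pres_class S R u. \<Union>v'\<in>pres_class S R v. pres_class S R (u' @ v')) =
    (\<Union>u'\<in>pres_class S R u. \<Union>v'\<in>pres_class S R v. pres_class S R (u @ v))"
    by (intro SUP_cong HOL.refl) (simp add: pres_class_def)
  moreover have "u \<in> pres_class S R u" "v \<in> pres_class S R v"
    using assms by (simp_all add: pres_class_def pres_eq.refl)
  then have "pres_class S R u \<noteq> {}" "pres_class S R v \<noteq> {}" by blast+
  ultimately show ?thesis
    by (simp add: presented_group_def)
qed

lemma presented_group_is_group: "group (presented_group S R)"
proof (rule groupI)
  let ?G = "presented_group S R"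
  let ?c = "pres_class S R"
  have carr: "carrier ?G = ?c ` gwords S" and one: "\<one>\<^bsub>?G\<^esub> = ?c []"
    by (simp_all add: presented_group_def)
  have nil: "[] \<in> gwords S" by (simp add: gwords_def)
  have app: "u @ v \<in> gwords S" if "u \<in> gwords S" "v \<in> gwords S" for u v
    using that by (simp add: gwords_def)
  show "x \<otimes>\<^bsub>?G\<^esub> y \<in> carrier ?G" if "x \<in> carrier ?G" "y \<in> carrier ?G" for x y
    using that by (auto simp: carr presented_group_mult app)
  show "\<one>\<^bsub>?G\<^esub> \<in> carrier ?G" by (simp add: carr one nil)
  show "x \<otimes>\<^bsub>?G\<^esub> y \<otimes>\<^bsub>?G\<^esub> z = x \<otimes>\<^bsub>?G\<^esub> (y \<otimes>\<^bsub>?G\<^esub> z)"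
    if "x \<in> carrier ?G" "y \<in> carrier ?G" "z \<in> carrier ?G" for x y z
    using that by (auto simp: carr presented_group_mult app)
  show "\<one>\<^bsub>?G\<^esub> \<otimes>\<^bsub>?G\<^esub> x = x" if "x \<in> carrier ?G" for x
    using that by (auto simp: carr one presented_group_mult nil)
  show "\<exists>y\<in>carrier ?G. y \<otimes>\<^bsub>?G\<^esub> x = \<one>\<^bsub>?G\<^esub>" if x: "x \<in> carrier ?G" for x
  proof -
    obtain u where u: "u \<in> gwords S" "x = ?c u" using x by (auto simp: carr)
    have "\<exists>v\<in>gwords S. pres_eq S R (v @ u) []"
      using u(1)
    proof (induction u)
      case Nil
      then show ?case using nil by (auto intro!: bexI[of _ "[]"] pres_eq.refl)
    next
      case (Cons a u)
      obtain s b where a: "a = (s, b)" by (cases a)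
      have s: "s \<in> S" and uS: "u \<in> gwords S" using Cons.prems a by (auto simp: gwords_def)
      obtain v where v: "v \<in> gwords S" "pres_eq S R (v @ u) []" using Cons.IH[OF uS] by blast
      have "pres_eq S R ([(s, \<not> b), (s, b)] @ u) ([] @ u)"
        using pres_eq.append[OF pres_eq.cancel[OF s] pres_eq.refl[OF uS], of R "\<not> b"] by simp
      then have "pres_eq S R (v @ ([(s, \<not> b), (s, b)] @ u)) (v @ ([] @ u))"
        by (rule pres_eq.append[OF pres_eq.refl[OF v(1)]])
      then have "pres_eq S R ((v @ [(s, \<not> b)]) @ (a # u)) (v @ u)"
        by (simp add: a)
      then have "pres_eq S R ((v @ [(s, \<not> b)]) @ (a # u)) []"
        using v(2) by (rule pres_eq.trans)
      moreover have "v @ [(s, \<not> b)] \<in> gwords S" using v(1) s by (simp add: gwords_def)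
      ultimately show ?case by blast
    qed
    then obtain v where v: "v \<in> gwords S" "pres_eq S R (v @ u) []" by blast
    have "?c v \<otimes>\<^bsub>?G\<^esub> x = ?c []"
      using v u by (simp add: presented_group_mult pres_class_eq_iff app)
    then show ?thesis using v(1) by (auto simp: carr one)
  qed
qed


section \<open>Coxeter groups and Weyl groups\<close>

text \<open>An exponent \<open>\<infinity>\<close> means that there is no relation between the two generators.\<close>

definition coxeter_relators :: "'i set \<Rightarrow> ('i \<Rightarrow> 'i \<Rightarrow> enat) \<Rightarrow> 'i gword set" where
  "coxeter_relators S m =
    {[(s, True), (s, True)] | s. s \<in> S} \<union>
    {concat (replicate k [(s, True), (t, True)]) | s t k.
       s \<in> S \<and> t \<in> S \<and> s \<noteq> t \<and> m s t = enat k}"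

definition coxeter_group :: "'i set \<Rightarrow> ('i \<Rightarrow> 'i \<Rightarrow> enat) \<Rightarrow> 'i gword set monoid" where
  "coxeter_group S m = presented_group S (coxeter_relators S m)"

definition coxeter_gen :: "'i set \<Rightarrow> ('i \<Rightarrow> 'i \<Rightarrow> enat) \<Rightarrow> 'i \<Rightarrow> 'i gword set" where
  "coxeter_gen S m s = pres_class S (coxeter_relators S m) [(s, True)]"

definition weyl_exponent :: "('i \<Rightarrow> 'i \<Rightarrow> int) \<Rightarrow> 'i \<Rightarrow> 'i \<Rightarrow> enat" where
  "weyl_exponent A i j =
    (let p = A i j * A j i in
     if p = 0 then 2 else if p = 1 then 3 else if p = 2 then 4 else if p = 3 then 6 else \<infinity>)"

definition weyl_group :: "'i set \<Rightarrow> ('i \<Rightarrow> 'i \<Rightarrow> int) \<Rightarrow> 'i gword set monoid" where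
  "weyl_group I A = coxeter_group I (weyl_exponent A)"

definition weyl_gen :: "'i set \<Rightarrow> ('i \<Rightarrow> 'i \<Rightarrow> int) \<Rightarrow> 'i \<Rightarrow> 'i gword set" where
  "weyl_gen I A i = coxeter_gen I (weyl_exponent A) i"

definition even_weyl_group :: "'i set \<Rightarrow> ('i \<Rightarrow> 'i \<Rightarrow> int) \<Rightarrow> 'i gword set monoid" where
  "even_weyl_group I A =
    (weyl_group I A)\<lparr>carrier :=
      {foldr (\<otimes>\<^bsub>weyl_group I A\<^esub>) (map (weyl_gen I A) is) \<one>\<^bsub>weyl_group I A\<^esub> | is.
         is \<in> lists I \<and> even (length is)}\<rparr>"


section \<open>The over-extension of \<open>C\<^sub>2\<close>\<close>

definition C2pp_nodes :: "int set" where
  "C2pp_nodes = {-1, 0, 1, 2}"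

text \<open>The Cartan matrix with entries \<open>2 (\<alpha>\<^sub>I, \<alpha>\<^sub>J) / (\<alpha>\<^sub>I, \<alpha>\<^sub>I)\<close>. The simple root \<open>\<alpha>\<^sub>1\<close> is short;
  \<open>\<alpha>\<^sub>2\<close>, the affine simple root \<open>\<alpha>\<^sub>0\<close> and the over-extended simple root \<open>\<alpha>\<^sub>-\<^sub>1\<close> are long.\<close>

definition C2pp_cartan :: "int \<Rightarrow> int \<Rightarrow> int" where
  "C2pp_cartan i j =
    (if i = j then 2
     else if (i, j) \<in> {(-1, 0), (0, -1), (0, 1), (2, 1)} then -1
     else if (i, j) \<in> {(1, 0), (1, 2)} then -2
     else 0)"

lemma C2pp_exponents:
  assumes "i \<in> C2pp_nodes" "j \<in> C2pp_nodes" "i \<noteq> j"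
  shows "weyl_exponent C2pp_cartan i j =
    (if {i, j} = {-1, 0} then 3 else if {i, j} = {0, 1} \<or> {i, j} = {1, 2} then 4 else 2)"
  using assms unfolding C2pp_nodes_def
  by (elim insertE emptyE; simp add: weyl_exponent_def C2pp_cartan_def doubleton_eq_iff)


section \<open>The group \<open>PSL\<^sub>2\<close> over the Gaussian integers\<close>

definition gaussian_ints :: "complex set" where
  "gaussian_ints = {of_int a + \<i> * of_int b | a b. True}"

definition SL2Zi :: "(complex^2^2) monoid" where
  "SL2Zi =
    \<lparr>carrier = {M. (\<forall>i j. M $ i $ j \<in> gaussian_ints) \<and> det M = 1},
     monoid.mult = (**),
     one = mat 1\<rparr>"

definition PSL2Zi :: "(complex^2^2) set monoid" where
  "PSL2Zi = SL2Zi Mod {mat 1, - mat 1}"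

lemma gaussian_ints_iff: "z \<in> gaussian_ints \<longleftrightarrow> Re z \<in> \<int> \<and> Im z \<in> \<int>"
proof
  assume "Re z \<in> \<int> \<and> Im z \<in> \<int>"
  then obtain a b where "Re z = of_int a" "Im z = of_int b" by (auto elim!: Ints_cases)
  then have "z = of_int a + \<i> * of_int b" by (simp add: complex_eq_iff)
  then show "z \<in> gaussian_ints" by (auto simp: gaussian_ints_def)
qed (auto simp: gaussian_ints_def)

lemma SL2Zi_is_group: "group SL2Zi"
proof (rule groupI)
  show "\<exists>N\<in>carrier SL2Zi. N \<otimes>\<^bsub>SL2Zi\<^esub> M = \<one>\<^bsub>SL2Zi\<^esub>" if "M \<in> carrier SL2Zi" for M
  proof -
    define N :: "complex^2^2" where
      "N = vector [vector [M $ 2 $ 2, - M $ 1 $ 2], vector [- M $ 2 $ 1, M $ 1 $ 1]]"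
    have "N \<in> carrier SL2Zi"
      using that by (simp add: N_def SL2Zi_def det_2 forall_2 gaussian_ints_iff mult.commute)
    moreover have "N ** M = mat 1"
      using that
      by (simp add: N_def SL2Zi_def det_2 vec_eq_iff forall_2 matrix_matrix_mult_def mat_def
          sum_2 algebra_simps)
    ultimately show ?thesis by (auto simp: SL2Zi_def)
  qed
  show "M \<otimes>\<^bsub>SL2Zi\<^esub> N \<in> carrier SL2Zi" if "M \<in> carrier SL2Zi" "N \<in> carrier SL2Zi" for M N
    using that
    by (auto simp: SL2Zi_def det_mul) (simp add: gaussian_ints_iff matrix_matrix_mult_def sum_2)
  show "\<one>\<^bsub>SL2Zi\<^esub> \<in> carrier SL2Zi"
    by (auto simp: SL2Zi_def gaussian_ints_iff mat_def det_2)
qed (simp_all add: SL2Zi_def matrix_mul_assoc)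

lemma center_normal_SL2Zi: "{mat 1, - mat 1} \<lhd> SL2Zi"
proof -
  interpret group SL2Zi by (rule SL2Zi_is_group)
  have neg: "- mat 1 ** M = - M" "M ** - mat 1 = - M" for M :: "complex^2^2"
    by (simp_all add: vec_eq_iff forall_2 matrix_matrix_mult_def mat_def sum_2)
  have minus: "- mat 1 \<in> carrier SL2Zi"
    by (simp add: SL2Zi_def mat_def det_2 forall_2 gaussian_ints_iff)
  have mult: "M \<otimes>\<^bsub>SL2Zi\<^esub> N = M ** N" and one: "\<one>\<^bsub>SL2Zi\<^esub> = mat 1" for M N
    by (simp_all add: SL2Zi_def)
  have inv: "inv\<^bsub>SL2Zi\<^esub> (- mat 1) = - mat 1"
    using minus by (intro inv_equality) (simp_all add: mult one neg)
  have "subgroup {mat 1, - mat 1} SL2Zi"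
    using minus one_closed inv inv_one
    by (intro subgroup.intro) (auto simp: mult one neg)
  moreover have "M \<otimes>\<^bsub>SL2Zi\<^esub> Z \<otimes>\<^bsub>SL2Zi\<^esub> inv\<^bsub>SL2Zi\<^esub> M \<in> {mat 1, - mat 1}"
    if M: "M \<in> carrier SL2Zi" and Z: "Z \<in> {mat 1, - mat 1}" for M Z
  proof -
    have "M \<otimes>\<^bsub>SL2Zi\<^esub> Z = Z \<otimes>\<^bsub>SL2Zi\<^esub> M" using Z by (auto simp: mult neg)
    moreover have "Z \<in> carrier SL2Zi" using Z minus one_closed by (auto simp: one)
    ultimately have "M \<otimes>\<^bsub>SL2Zi\<^esub> Z \<otimes>\<^bsub>SL2Zi\<^esub> inv\<^bsub>SL2Zi\<^esub> M = Z"
      using M by (simp add: m_assoc)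
    then show ?thesis using Z by simp
  qed
  ultimately show ?thesis by (simp add: normal_inv_iff)
qed


section \<open>Split extensions by a group of order 2\<close>

text \<open>\<open>G\<close> is a semidirect product of \<open>A\<close> with a group of order 2: the complement \<open>K\<close> acts on
  the normal subgroup \<open>N\<close> by conjugation, and this action may be any one.\<close>

definition semidirect_by_2 :: "('a, 'c) monoid_scheme \<Rightarrow> ('b, 'd) monoid_scheme \<Rightarrow> bool" where
  "semidirect_by_2 G A \<longleftrightarrow>
    (\<exists>N K. N \<lhd> G \<and> G\<lparr>carrier := N\<rparr> \<cong> A \<and> card (rcosets\<^bsub>G\<^esub> N) = 2 \<and>
           subgroup K G \<and> card K = 2 \<and> N \<inter> K = {\<one>\<^bsub>G\<^esub>} \<and> N <#>\<^bsub>G\<^esub> K = carrier G)"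

end

theory Submission
  imports Defs
begin

text \<open>
  The Weyl group is the reflection group of a hyperbolic tetrahedron. On the boundary sphere of
  hyperbolic 3-space its four generators act by the anti-holomorphic maps
  \<open>z \<mapsto> 1 / cnj z\<close>, \<open>z \<mapsto> 1 - cnj z\<close>, \<open>z \<mapsto> \<i> * cnj z\<close>, \<open>z \<mapsto> cnj z\<close> (nodes \<open>-1, 0, 1, 2\<close>), the
  reflections in the walls of the part of the upper half-space that lies over the region
  \<open>0 \<le> Im z \<le> Re z \<le> 1/2\<close> and outside the unit sphere. An even
  word is thus a Moebius transformation with Gaussian coefficients, that is, a matrix up to one of
  the four Gaussian units. Its determinant is \<open>\<plusminus>1\<close> if the letter \<open>1\<close> occurs an even number of
  times and \<open>\<plusminus>\<i>\<close> otherwise. Since the squares of the units are \<open>\<plusminus>1\<close>, the first kind of matrix can be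
  rescaled to determinant 1, in exactly two ways that differ by a sign. So the parity of the
  letter \<open>1\<close> defines a subgroup \<open>N\<close> of index 2 in the even Weyl group, with a map to
  \<open>PSL\<^sub>2\<close> of the Gaussian integers. The commuting reflections of the nodes \<open>-1\<close> and \<open>1\<close> have as
  product an involution outside \<open>N\<close>, which spans a complement (\<open>semidirect_by_2I\<close>).

  The map is injective because the reflections satisfy no relations beyond the Coxeter relations.
  This is Tits' theorem, proved in the locale \<open>root_positivity\<close> for an abstract linear action: if a
  reduced word cannot be shortened by appending \<open>s\<close>, then it sends the root of \<open>s\<close> to a positive
  vector (\<open>ascent_root_pos\<close>), so a word that acts trivially must be trivial in the group. Here the
  linear action is the one on Hermitian matrices by \<open>X \<mapsto> M (cnj X) M\<^sup>*\<close>, which depends on \<open>M\<close> only up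
  to units, and which in terms of four explicit roots is given by the Cartan matrix
  (\<open>herm_act_root\<close>). The result is \<open>weyl_elt_eq_iff\<close>: two words agree in the Weyl group iff their
  matrices agree up to a unit and their parities agree.

  The map is surjective because the Gaussian integers are Euclidean: left multiplication by
  translations and by the inversion \<open>z \<mapsto> -1/z\<close>, all of which come from explicit words, reduces any
  matrix to a triangular one (\<open>SL2Zi_realised\<close>).
\<close>

section \<open>Words, their products, and alternating words\<close>

definition word_prod :: "('a, 'b) monoid_scheme \<Rightarrow> ('i \<Rightarrow> 'a) \<Rightarrow> 'i list \<Rightarrow> 'a" where
  "word_prod G g w = foldr (\<otimes>\<^bsub>G\<^esub>) (map g w) \<one>\<^bsub>G\<^esub>"

lemma word_prod_Nil [simp]: "word_prod G g [] = \<one>\<^bsub>G\<^esub>"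
  and word_prod_Cons [simp]: "word_prod G g (s # w) = g s \<otimes>\<^bsub>G\<^esub> word_prod G g w"
  by (simp_all add: word_prod_def)

lemma (in monoid) word_prod_closed:
  assumes "\<And>s. s \<in> S \<Longrightarrow> g s \<in> carrier G" "w \<in> lists S"
  shows "word_prod G g w \<in> carrier G"
  using assms(2) by induction (auto simp: assms(1))

lemma (in monoid) word_prod_append:
  assumes "\<And>s. s \<in> S \<Longrightarrow> g s \<in> carrier G" "u \<in> lists S" "v \<in> lists S"
  shows "word_prod G g (u @ v) = word_prod G g u \<otimes> word_prod G g v"
  using assms(2) by induction (auto simp: assms word_prod_closed[OF assms(1)] m_assoc)

fun alternating :: "'i \<Rightarrow> 'i \<Rightarrow> nat \<Rightarrow> 'i list" where
  "alternating s t 0 = []"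
| "alternating s t (Suc n) = s # alternating t s n"

lemma length_alternating [simp]: "length (alternating s t n) = n"
  by (induction s t n rule: alternating.induct) auto

lemma alternating_in_lists: "s \<in> S \<Longrightarrow> t \<in> S \<Longrightarrow> alternating s t n \<in> lists S"
  by (induction s t n rule: alternating.induct) auto

lemma alternating_add:
  "alternating s t (k + i) = alternating s t k @ (if even k then alternating s t i else alternating t s i)"
  by (induction s t k rule: alternating.induct) auto

lemma rev_in_lists: "rev w \<in> lists S \<longleftrightarrow> w \<in> lists S"
  by (simp add: in_lists_conv_set)

lemma alternating_even: "alternating s t (2 * k) = concat (replicate k [s, t])"
  by (induction k) auto

text \<open>Reversing an alternating word that starts with \<open>t\<close> makes it end with \<open>t\<close>, so an alternating word
  starting with \<open>s\<close> continues it. Which letter comes first depends on the parity of \<open>j\<close>.\<close>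

lemma rev_alternating_append:
  "rev (alternating t s j) @ alternating s t i \<in> {alternating s t (j + i), alternating t s (j + i)}"
proof (induction j arbitrary: s t i)
  case (Suc j)
  show ?case using Suc.IH[of s t "Suc i"] by auto
qed simp

lemma distinct_adj_alternating:
  assumes "y \<in> lists {s, t}" "distinct_adj y" "y \<noteq> [] \<longrightarrow> hd y = t"
  shows "y = alternating t s (length y)"
  using assms
proof (induction y arbitrary: s t rule: list.induct)
  case (Cons a y)
  have "a = t" using Cons.prems(3) by simp
  moreover have "set y \<subseteq> {s, t}" using Cons.prems(1) by (simp add: in_lists_conv_set subset_iff)
  ultimately have "y \<noteq> [] \<Longrightarrow> hd y = s"
    using Cons.prems(2) by (cases y) auto
  moreover have "y \<in> lists {t, s}" using Cons.prems by auto
  moreover have "distinct_adj y" using Cons.prems by (simp add: distinct_adj_ConsD)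
  ultimately show ?case using Cons.IH[of t s] Cons.prems by simp
qed simp

section \<open>Faithfulness from positive roots\<close>

text \<open>A linear action of a group on a real vector space that looks like the action of a Coxeter group on
  its roots. The convex cone \<open>P\<close> stands for the nonnegative combinations of simple roots. Positivity
  is assumed for dihedral subgroups only: \<open>rank_two\<close> says that a word in \<open>s, t\<close> that is shorter than
  the braid relation and ends in \<open>t\<close> sends the root of \<open>s\<close> to a nonnegative combination of the two roots.
  That the action is well defined on the group is \<open>act_cong\<close>.\<close>

locale root_positivity = group G for G (structure) +
  fixes S :: "'i set" and m :: "'i \<Rightarrow> 'i \<Rightarrow> enat" and gen :: "'i \<Rightarrow> 'a"
    and act :: "'i \<Rightarrow> 'v::real_vector \<Rightarrow> 'v" and root :: "'i \<Rightarrow> 'v" and P :: "'v set"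
  assumes gen_closed: "s \<in> S \<Longrightarrow> gen s \<in> carrier G"
    and gen_sq: "s \<in> S \<Longrightarrow> gen s \<otimes> gen s = \<one>"
    and gen_braid: "\<lbrakk>s \<in> S; t \<in> S; s \<noteq> t; m s t = enat k\<rbrakk> \<Longrightarrow>
      word_prod G gen (concat (replicate k [s, t])) = \<one>"
    and m_sym: "m s t = m t s"
    and m_nonzero: "m s t \<noteq> 0"
    and act_linear: "s \<in> S \<Longrightarrow> linear (act s)"
    and act_cong: "\<lbrakk>u \<in> lists S; v \<in> lists S; word_prod G gen u = word_prod G gen v\<rbrakk> \<Longrightarrow>
      foldr act u = foldr act v"
    and act_root: "s \<in> S \<Longrightarrow> act s (root s) = - root s"
    and cone: "\<lbrakk>x \<in> P; y \<in> P; 0 \<le> a; 0 \<le> b\<rbrakk> \<Longrightarrow> a *\<^sub>R x + b *\<^sub>R y \<in> P"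
    and root_pos: "s \<in> S \<Longrightarrow> root s \<in> P"
    and neg_root_not_pos: "s \<in> S \<Longrightarrow> - root s \<notin> P"
    and rank_two: "\<lbrakk>s \<in> S; t \<in> S; s \<noteq> t; enat j < m s t\<rbrakk> \<Longrightarrow>
      \<exists>a\<ge>0. \<exists>b\<ge>0. foldr act (rev (alternating t s j)) (root s) = a *\<^sub>R root s + b *\<^sub>R root t"
begin

abbreviation elt :: "'i list \<Rightarrow> 'a" where
  "elt \<equiv> word_prod G gen"

definition reduced :: "'i list \<Rightarrow> bool" where
  "reduced w \<longleftrightarrow> w \<in> lists S \<and> (\<forall>v\<in>lists S. elt v = elt w \<longrightarrow> length w \<le> length v)"

lemma elt_closed: "w \<in> lists S \<Longrightarrow> elt w \<in> carrier G"
  by (rule word_prod_closed[OF gen_closed])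

lemma elt_append: "u \<in> lists S \<Longrightarrow> v \<in> lists S \<Longrightarrow> elt (u @ v) = elt u \<otimes> elt v"
  by (rule word_prod_append[OF gen_closed])

lemma gen_gen_cancel: "s \<in> S \<Longrightarrow> x \<in> carrier G \<Longrightarrow> gen s \<otimes> (gen s \<otimes> x) = x"
  by (simp add: gen_closed gen_sq flip: m_assoc)

lemma elt_rev: "w \<in> lists S \<Longrightarrow> elt (rev w) = inv (elt w)"
proof (induction w)
  case (Cons s w)
  then have "inv gen s = gen s" by (auto intro!: inv_equality gen_sq gen_closed)
  then show ?case
    using Cons elt_append[of "rev w" "[s]"]
    by (simp add: elt_closed gen_closed inv_mult_group rev_in_lists)
qed simp

lemma exists_reduced:
  assumes "w \<in> lists S"
  obtains v where "reduced v" "elt v = elt w"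
proof -
  define v where "v = arg_min length (\<lambda>v. v \<in> lists S \<and> elt v = elt w)"
  have "v \<in> lists S \<and> elt v = elt w"
    unfolding v_def by (rule arg_min_natI[of _ w]) (simp add: assms)
  moreover have "length v \<le> length u" if "u \<in> lists S" "elt u = elt w" for u
    unfolding v_def by (rule arg_min_nat_le) (simp add: that)
  ultimately show thesis by (intro that[of v]) (simp_all add: reduced_def)
qed

lemma reduced_append:
  assumes "reduced (u @ v)"
  shows "reduced u" "reduced v"
proof -
  have uv: "u \<in> lists S" "v \<in> lists S" using assms by (auto simp: reduced_def)
  have "length u \<le> length u'" if "u' \<in> lists S" "elt u' = elt u" for u'
  proof -
    have "elt (u' @ v) = elt (u @ v)" "u' @ v \<in> lists S"
      using that uv by (simp_all add: elt_append)
    then show ?thesis using assms by (force simp: reduced_def)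
  qed
  then show "reduced u" using uv by (simp add: reduced_def)
  have "length v \<le> length v'" if "v' \<in> lists S" "elt v' = elt v" for v'
  proof -
    have "elt (u @ v') = elt (u @ v)" "u @ v' \<in> lists S"
      using that uv by (simp_all add: elt_append)
    then show ?thesis using assms by (force simp: reduced_def)
  qed
  then show "reduced v" using uv by (simp add: reduced_def)
qed

lemma reduced_distinct_adj: "reduced w \<Longrightarrow> distinct_adj w"
proof (induction w rule: induct_list012)
  case (3 a b w)
  have "a \<noteq> b"
  proof
    assume "a = b"
    then have "elt w = elt (a # b # w)" "w \<in> lists S"
      using 3(3) by (auto simp: reduced_def gen_gen_cancel elt_closed)
    then show False using 3(3) by (auto simp: reduced_def)
  qed
  moreover have "distinct_adj (b # w)"
    using 3(2) reduced_append(2)[of "[a]" "b # w"] 3(3) by simp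
  ultimately show ?case by simp
qed simp_all

text \<open>The relator of length \<open>2 * k\<close> is one alternating word of length \<open>k\<close> followed by the reverse of the
  other, hence the two alternating words of length \<open>k\<close> are equal.\<close>

lemma braid_relation:
  assumes "s \<in> S" "t \<in> S" "s \<noteq> t" "m s t = enat k"
  shows "elt (rev (alternating t s k)) = elt (rev (alternating s t k))"
proof -
  have "elt (alternating s t (k + k)) = \<one>" "elt (alternating t s (k + k)) = \<one>"
    using gen_braid[of s t k] gen_braid[of t s k] assms m_sym[of s t]
    by (simp_all add: alternating_even flip: mult_2)
  then have "elt (rev (alternating t s k) @ alternating s t k) = \<one>"
    using rev_alternating_append[of t s k k] by auto
  then have "elt (rev (alternating t s k)) \<otimes> elt (alternating s t k) = \<one>"
    using assms alternating_in_lists[of s S t] alternating_in_lists[of t S s]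
    by (simp add: elt_append rev_in_lists)
  then show ?thesis
    using assms alternating_in_lists[of s S t] alternating_in_lists[of t S s]
    by (simp add: elt_rev[of "alternating s t k"] inv_equality[symmetric] elt_closed rev_in_lists)
qed

lemma act_word_linear: "w \<in> lists S \<Longrightarrow> linear (foldr act w)"
proof (induction w)
  case (Cons s w)
  then show ?case
    using linear_compose[of "foldr act w" "act s"] act_linear[of s] by (simp add: o_def)
qed (simp add: linear_id[unfolded id_def] id_def)

text \<open>Tits' argument, by induction on the length of \<open>w\<close>. Let \<open>t\<close> be the last letter of \<open>w\<close>, and split off
  from \<open>w\<close> the longest possible tail \<open>x\<close> in the letters \<open>s, t\<close>, so that \<open>w = v x\<close> with lengths adding
  up. Then \<open>v\<close> can be shortened neither by \<open>s\<close> nor by \<open>t\<close>, and by induction it sends both roots into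
  the cone. The tail \<open>x\<close> alternates and ends in \<open>t\<close>, since otherwise appending \<open>s\<close> would shorten \<open>w\<close>; for the
  same reason the braid relation cannot be applied at its end, so \<open>x\<close> is shorter than that relation. Now the
  dihedral assumption applies to \<open>x\<close>.\<close>

lemma ascent_root_pos:
  assumes "reduced w" "s \<in> S"
    and "\<And>v. v \<in> lists S \<Longrightarrow> elt v = elt w \<otimes> gen s \<Longrightarrow> length w \<le> length v"
  shows "foldr act w (root s) \<in> P"
  using assms
proof (induction "length w" arbitrary: w s rule: less_induct)
  case less
  note red = less.prems(1) and s = less.prems(2) and asc = less.prems(3)
  have wS: "w \<in> lists S" using red by (simp add: reduced_def)
  show ?case
  proof (cases w rule: rev_cases)
    case Nil
    then show ?thesis by (simp add: root_pos s)
  next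
    case (snoc w' t)
    have t: "t \<in> S" and w'S: "w' \<in> lists S" using wS snoc by auto
    have "s \<noteq> t"
    proof
      assume "s = t"
      then have "elt w' = elt w \<otimes> gen s"
        using w'S t by (simp add: snoc elt_append m_assoc gen_closed gen_sq elt_closed)
      from asc[OF w'S this] show False by (simp add: snoc)
    qed
    define fac where
      "fac v x \<longleftrightarrow> v \<in> lists S \<and> x \<in> lists {s, t} \<and> elt (v @ x) = elt w \<and> length v + length x = length w"
      for v x
    define v where "v = arg_min length (\<lambda>v. \<exists>x. fac v x)"
    have start: "fac w' [t]" using w'S by (simp add: fac_def snoc)
    have "\<exists>x. fac v x"
      unfolding v_def by (rule arg_min_natI[of _ w']) (use start in blast)
    then obtain x where x: "fac v x" by blast
    have v_min: "length v \<le> length v'" if "fac v' x'" for v' x'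
      unfolding v_def by (rule arg_min_nat_le) (use that in blast)
    have vS: "v \<in> lists S" and xst: "x \<in> lists {s, t}" and vx: "elt (v @ x) = elt w"
      and len: "length v + length x = length w"
      using x by (simp_all add: fac_def)
    have xS: "x \<in> lists S" using xst s t by auto
    have "length v < length w" using v_min[OF start] by (simp add: snoc)
    have red_vx: "reduced (v @ x)"
      using red vS xS len by (auto simp: reduced_def vx)
    \<comment> \<open>If appending \<open>r\<close> shortened \<open>v\<close>, the letter \<open>r\<close> could be moved from \<open>v\<close> to \<open>x\<close>, against minimality.\<close>
    have "foldr act v (root r) \<in> P" if r: "r \<in> {s, t}" for r
    proof (rule less.hyps[OF \<open>length v < length w\<close> reduced_append(1)[OF red_vx]])
      show rS: "r \<in> S" using r s t by auto
      fix v' assume v': "v' \<in> lists S" "elt v' = elt v \<otimes> gen r"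
      show "length v \<le> length v'"
      proof (rule ccontr)
        assume less_len: "\<not> length v \<le> length v'"
        have eq: "elt (v' @ r # x) = elt w"
          using v' vS xS rS
          by (simp add: elt_append elt_closed gen_closed m_assoc gen_gen_cancel flip: vx)
        moreover have "v' @ r # x \<in> lists S" using v' rS xS by auto
        ultimately have "length w \<le> length (v' @ r # x)"
          using red unfolding reduced_def by blast
        then have "fac v' (r # x)"
          using less_len len v' eq r xst by (auto simp: fac_def)
        then show False using v_min less_len by blast
      qed
    qed
    then have vs: "foldr act v (root s) \<in> P" and vt: "foldr act v (root t) \<in> P" by auto
    \<comment> \<open>No word for \<open>x\<close> of at most its length ends in \<open>s\<close>, because that \<open>s\<close> would cancel in \<open>w s\<close>.\<close>
    have no_s: "elt x' \<noteq> elt x"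
      if "x' = y @ [s]" "length x' \<le> length x" "y \<in> lists S" for x' y
    proof
      assume "elt x' = elt x"
      then have "elt (v @ y) = elt w \<otimes> gen s"
        using that vS xS s
        by (simp add: elt_append elt_closed gen_closed m_assoc gen_sq flip: vx)
           (metis elt_closed gen_closed gen_sq m_assoc r_one)
      from asc[OF _ this] show False using that len vS by auto
    qed
    have "rev x = alternating t s (length (rev x))"
    proof (rule distinct_adj_alternating)
      show "rev x \<in> lists {s, t}" using xst by auto
      show "distinct_adj (rev x)" using reduced_distinct_adj[OF reduced_append(2)[OF red_vx]] by simp
      have "hd (rev x) = t" if "rev x \<noteq> []"
      proof -
        have "last x \<in> {s, t}" "x = butlast x @ [last x]"
          using xst that by (auto simp: in_lists_conv_set)
        moreover have "last x \<noteq> s"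
          using no_s[of x "butlast x"] xS \<open>x = butlast x @ [last x]\<close>
          by (metis append_in_lists_conv order_refl)
        ultimately show ?thesis by (simp add: hd_rev)
      qed
      then show "rev x \<noteq> [] \<longrightarrow> hd (rev x) = t" ..
    qed
    then have x_alt: "x = rev (alternating t s (length x))" by (metis length_rev rev_rev_ident)
    have "enat (length x) < m s t"
    proof (rule ccontr)
      assume "\<not> enat (length x) < m s t"
      then obtain k where k: "m s t = enat k" "k \<le> length x" by (cases "m s t") auto
      \<comment> \<open>If \<open>x\<close> had at least that length, it would end in one side of the braid relation; the other side ends in \<open>s\<close>.\<close>
      obtain R where R: "alternating t s (length x) = alternating t s k @ R"
        using alternating_add[of t s k "length x - k"] k(2) by auto
      have RS: "R \<in> lists S"
        using alternating_in_lists[OF t s, of "length x"] by (simp add: R)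
      obtain i where i: "k = Suc i" using m_nonzero[of s t] k(1) by (cases k) (auto simp: zero_enat_def)
      have alt: "rev (alternating s t k) \<in> lists S" "rev (alternating t s k) \<in> lists S"
        using alternating_in_lists[OF t s, of k] alternating_in_lists[OF s t, of k]
        by (simp_all add: rev_in_lists)
      have revR: "rev R \<in> lists S" using RS by (simp add: rev_in_lists)
      have "elt x = elt (rev R @ rev (alternating t s k))"
        by (subst x_alt) (simp add: R)
      also have "\<dots> = elt (rev R @ rev (alternating s t k))"
        using braid_relation[OF s t \<open>s \<noteq> t\<close> k(1)] revR alt by (simp add: elt_append)
      finally have "elt (rev R @ rev (alternating s t k)) = elt x" ..
      moreover have "rev R @ rev (alternating s t k) = (rev R @ rev (alternating t s i)) @ [s]"
        by (simp add: i)
      moreover have "length (rev R @ rev (alternating s t k)) \<le> length x"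
        using arg_cong[OF R, of length] by simp
      moreover have "rev R @ rev (alternating t s i) \<in> lists S"
        using revR alt by (simp add: i)
      ultimately show False using no_s by blast
    qed
    from rank_two[OF s t \<open>s \<noteq> t\<close> this]
    obtain a b where ab: "a \<ge> 0" "b \<ge> 0"
      and "foldr act x (root s) = a *\<^sub>R root s + b *\<^sub>R root t"
      using x_alt by metis
    then have "foldr act (v @ x) (root s) = a *\<^sub>R foldr act v (root s) + b *\<^sub>R foldr act v (root t)"
      using act_word_linear[OF vS] by (simp add: linear_add linear_scale)
    also have "\<dots> \<in> P" by (rule cone[OF vs vt ab])
    also have "foldr act (v @ x) = foldr act w"
      by (rule act_cong[OF _ wS vx]) (use vS xS in simp)
    finally show ?thesis .
  qed
qed

text \<open>If \<open>w\<close> were nontrivial, a reduced word for it would be \<open>u t\<close> with \<open>u\<close> sending the root of \<open>t\<close> to a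
  positive vector, so \<open>w\<close> would send that root to a negative vector and could not fix it.\<close>

theorem faithful:
  assumes w: "w \<in> lists S" and triv: "\<And>s. s \<in> S \<Longrightarrow> foldr act w (root s) = root s"
  shows "elt w = \<one>"
proof -
  obtain v where v: "reduced v" "elt v = elt w" using exists_reduced[OF w] .
  have vS: "v \<in> lists S" using v by (simp add: reduced_def)
  show ?thesis
  proof (cases v rule: rev_cases)
    case Nil
    then show ?thesis using v by simp
  next
    case (snoc u t)
    have u: "u \<in> lists S" and t: "t \<in> S" using vS snoc by auto
    have "foldr act u (root t) \<in> P"
    proof (rule ascent_root_pos)
      show "reduced u" using v snoc reduced_append by blast
      fix x assume "x \<in> lists S" "elt x = elt u \<otimes> gen t"
      moreover have "elt u \<otimes> gen t = elt v"
        using u t by (simp add: snoc elt_append gen_closed)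
      ultimately have "length v \<le> length x" using v by (auto simp: reduced_def)
      then show "length u \<le> length x" by (simp add: snoc)
    qed (rule t)
    moreover have "foldr act v (root t) = root t"
      using act_cong[OF vS w v(2)] triv[OF t] by simp
    then have "foldr act u (root t) = - root t"
      using linear_neg[OF act_word_linear[OF u], of "root t"] act_root[OF t]
      by (simp add: snoc) (metis minus_minus)
    ultimately show ?thesis using neg_root_not_pos[OF t] by simp
  qed
qed

end

section \<open>Equality of words in a Coxeter group\<close>

definition positive_word :: "'i list \<Rightarrow> 'i gword" where
  "positive_word w = map (\<lambda>s. (s, True)) w"

lemma positive_word_simps [simp]:
  "positive_word [] = []"
  "positive_word (s # w) = (s, True) # positive_word w"
  "positive_word (u @ v) = positive_word u @ positive_word v"
  by (simp_all add: positive_word_def)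

lemma positive_word_in_gwords: "w \<in> lists S \<Longrightarrow> positive_word w \<in> gwords S"
  by (auto simp: positive_word_def gwords_def in_lists_conv_set)

lemma map_fst_in_lists: "g \<in> gwords S \<Longrightarrow> map fst g \<in> lists S"
  by (auto simp: gwords_def in_lists_conv_set)

abbreviation coxeter_elt :: "'i set \<Rightarrow> ('i \<Rightarrow> 'i \<Rightarrow> enat) \<Rightarrow> 'i list \<Rightarrow> 'i gword set" where
  "coxeter_elt S m \<equiv> word_prod (coxeter_group S m) (coxeter_gen S m)"

lemma coxeter_group_is_group: "group (coxeter_group S m)"
  unfolding coxeter_group_def by (rule presented_group_is_group)

lemma coxeter_elt_eq_class:
  "w \<in> lists S \<Longrightarrow> coxeter_elt S m w = pres_class S (coxeter_relators S m) (positive_word w)"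
proof (induction w)
  case Nil
  show ?case by (simp add: coxeter_group_def presented_group_def)
next
  case (Cons s w)
  then show ?case
    using presented_group_mult[of "[(s, True)]" S "positive_word w" "coxeter_relators S m"]
    by (simp add: coxeter_gen_def coxeter_group_def positive_word_in_gwords)
       (simp add: gwords_def)
qed

lemma coxeter_gen_closed: "s \<in> S \<Longrightarrow> coxeter_gen S m s \<in> carrier (coxeter_group S m)"
  by (simp add: coxeter_gen_def coxeter_group_def presented_group_def gwords_def)

lemma coxeter_gen_sq:
  assumes "s \<in> S"
  shows "coxeter_gen S m s \<otimes>\<^bsub>coxeter_group S m\<^esub> coxeter_gen S m s = \<one>\<^bsub>coxeter_group S m\<^esub>"
proof -
  interpret group "coxeter_group S m" by (rule coxeter_group_is_group)
  have "pres_eq S (coxeter_relators S m) (positive_word [s, s]) []"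
    using assms by (intro pres_eq.relator) (auto simp: coxeter_relators_def gwords_def)
  then have "coxeter_elt S m [s, s] = coxeter_elt S m []"
    using assms positive_word_in_gwords[of "[s, s]" S]
    by (simp only: coxeter_elt_eq_class pres_class_eq_iff Cons_in_lists_iff lists.Nil) simp
  then show ?thesis using assms by (simp add: coxeter_gen_closed)
qed

lemma coxeter_braid:
  assumes "s \<in> S" "t \<in> S" "s \<noteq> t" "m s t = enat k"
  shows "coxeter_elt S m (concat (replicate k [s, t])) = \<one>\<^bsub>coxeter_group S m\<^esub>"
proof -
  let ?w = "concat (replicate k [s, t])"
  have w: "?w \<in> lists S" using assms by (auto simp: in_lists_conv_set)
  have "positive_word ?w = concat (replicate k [(s, True), (t, True)])"
    by (simp add: positive_word_def map_concat)
  then have "pres_eq S (coxeter_relators S m) (positive_word ?w) []"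
    using assms positive_word_in_gwords[OF w]
    by (intro pres_eq.relator) (auto simp: coxeter_relators_def)
  then have "coxeter_elt S m ?w = coxeter_elt S m []"
    using positive_word_in_gwords[OF w] w
    by (simp only: coxeter_elt_eq_class pres_class_eq_iff lists.Nil) simp
  then show ?thesis by simp
qed

text \<open>The universal property of the presentation, phrased for congruences on words without formal inverses.\<close>

lemma coxeter_elt_eq_imp:
  fixes Q :: "'i list \<Rightarrow> 'i list \<Rightarrow> bool"
  assumes "equivp Q"
    and append: "\<And>u u' v v'. \<lbrakk>u \<in> lists S; u' \<in> lists S; v \<in> lists S; v' \<in> lists S; Q u u'; Q v v'\<rbrakk>
      \<Longrightarrow> Q (u @ v) (u' @ v')"
    and sq: "\<And>s. s \<in> S \<Longrightarrow> Q [s, s] []"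
    and braid: "\<And>s t k. \<lbrakk>s \<in> S; t \<in> S; s \<noteq> t; m s t = enat k\<rbrakk> \<Longrightarrow>
      Q (concat (replicate k [s, t])) []"
    and eq: "u \<in> lists S" "v \<in> lists S" "coxeter_elt S m u = coxeter_elt S m v"
  shows "Q u v"
proof -
  have "Q (map fst g) (map fst h)" if "pres_eq S (coxeter_relators S m) g h" for g h
    using that
  proof induction
    case (refl u)
    then show ?case using assms(1) by (simp add: equivp_reflp)
  next
    case (sym u v)
    then show ?case using assms(1) by (simp add: equivp_symp)
  next
    case (trans u v w)
    then show ?case using assms(1) by (blast intro: equivp_transp)
  next
    case (append u u' v v')
    then show ?case using assms(2) by (simp add: pres_eq_gwords map_fst_in_lists)
  next
    case (cancel s b)
    then show ?case by (simp add: sq)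
  next
    case (relator r)
    then show ?case by (auto simp: coxeter_relators_def sq braid map_concat)
  qed
  moreover have "map fst (positive_word w) = w" for w :: "'i list"
    by (simp add: positive_word_def o_def)
  ultimately show ?thesis
    using eq by (metis coxeter_elt_eq_class positive_word_in_gwords pres_class_eq_iff)
qed

section \<open>Split extensions from a parity\<close>


text \<open>A surjective homomorphism to the group of order 2, here a Boolean-valued parity, splits as soon as
  some element of odd parity is an involution.\<close>

lemma (in group) semidirect_by_2I:
  fixes A :: "('c, 'd) monoid_scheme" and odd_elt :: "'a \<Rightarrow> bool"
  assumes hom: "\<And>x y. x \<in> carrier G \<Longrightarrow> y \<in> carrier G \<Longrightarrow> odd_elt (x \<otimes> y) \<longleftrightarrow> odd_elt x \<noteq> odd_elt y"
    and k: "k \<in> carrier G" "odd_elt k" "k \<otimes> k = \<one>"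
    and iso: "G\<lparr>carrier := {x \<in> carrier G. \<not> odd_elt x}\<rparr> \<cong> A"
  shows "semidirect_by_2 G A"
  unfolding semidirect_by_2_def
proof (intro exI conjI)
  define N where "N = {x \<in> carrier G. \<not> odd_elt x}"
  have one: "\<not> odd_elt \<one>" using hom[of \<one> \<one>] by simp
  have inv: "odd_elt (inv x) \<longleftrightarrow> odd_elt x" if "x \<in> carrier G" for x
    using hom[of x "inv x"] that one by simp
  have sub: "subgroup N G"
  proof (rule subgroupI)
    show "N \<noteq> {}" using one by (auto simp: N_def)
  qed (auto simp: N_def hom inv)
  then show normal: "N \<lhd> G" by (auto simp: normal_inv_iff N_def hom inv)
  show "G\<lparr>carrier := N\<rparr> \<cong> A" using iso by (simp add: N_def)
  have kN: "N #> k = {x \<in> carrier G. odd_elt x}"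
  proof (intro equalityI subsetI)
    fix x assume "x \<in> {x \<in> carrier G. odd_elt x}"
    then have "x = (x \<otimes> k) \<otimes> k" "x \<otimes> k \<in> N" using k by (auto simp: N_def hom m_assoc)
    then show "x \<in> N #> k" unfolding r_coset_def by blast
  qed (use k in \<open>auto simp: r_coset_def N_def hom\<close>)
  have "rcosets N = {N, N #> k}"
  proof (intro equalityI subsetI)
    fix C assume "C \<in> rcosets N"
    then obtain x where x: "x \<in> carrier G" "C = N #> x" by (auto simp: RCOSETS_def)
    show "C \<in> {N, N #> k}"
    proof (cases "odd_elt x")
      case True
      then have "x \<in> N #> k" using x kN by simp
      then show ?thesis using repr_independence[of x N k] sub k x by simp
    next
      case False
      then show ?thesis using coset_join2[of x N] sub x by (simp add: N_def)
    qed
  next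
    fix C assume "C \<in> {N, N #> k}"
    then show "C \<in> rcosets N"
      using coset_join2[of \<one> N] sub k subgroup.one_closed[OF sub] one_closed
      unfolding RCOSETS_def by (metis (no_types, lifting) UN_I insertE singletonD singletonI)
  qed
  moreover have "N \<noteq> N #> k" using one unfolding kN by (auto simp: N_def)
  ultimately show "card (rcosets N) = 2" by simp
  have "\<one> \<noteq> k" using one k by auto
  then show "card {\<one>, k} = 2" by simp
  have "inv k = k" using k by (intro inv_equality) auto
  then show "subgroup {\<one>, k} G" using k by (intro subgroupI) auto
  show "N \<inter> {\<one>, k} = {\<one>}" using one k by (auto simp: N_def)
  show "N <#> {\<one>, k} = carrier G"
  proof -
    have "N <#> {\<one>, k} = N \<union> (N #> k)"
      by (auto simp: set_mult_def r_coset_def N_def)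
    then show ?thesis unfolding kN by (auto simp: N_def)
  qed
qed

section \<open>Semilinear matrices of the four reflections\<close>

definition conj_mat :: "complex^'n^'m \<Rightarrow> complex^'n^'m" where
  "conj_mat A = (\<chi> i j. cnj (A $ i $ j))"

lemma conj_mat_nth [simp]: "conj_mat A $ i $ j = cnj (A $ i $ j)"
  by (simp add: conj_mat_def)

lemma conj_mat_conj_mat [simp]: "conj_mat (conj_mat A) = A"
  by (simp add: vec_eq_iff)

lemma conj_mat_mult: "conj_mat (A ** B) = conj_mat A ** conj_mat B"
  by (simp add: vec_eq_iff matrix_matrix_mult_def)

lemma conj_mat_mat [simp]: "conj_mat (mat c) = mat (cnj c)"
  by (simp add: vec_eq_iff mat_def)

lemma conj_mat_transpose: "conj_mat (transpose A) = transpose (conj_mat A)"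
  by (simp add: vec_eq_iff transpose_def)

lemma conj_mat_pow_apply:
  "(conj_mat ^^ n) A = (if even n then A else conj_mat A)"
  by (induction n) auto

definition mat22 :: "'a \<Rightarrow> 'a \<Rightarrow> 'a \<Rightarrow> 'a \<Rightarrow> 'a::zero^2^2" where
  "mat22 a b c d = vector [vector [a, b], vector [c, d]]"

lemma mat22_nth [simp]:
  "mat22 a b c d $ 1 $ 1 = a" "mat22 a b c d $ 1 $ 2 = b"
  "mat22 a b c d $ 2 $ 1 = c" "mat22 a b c d $ 2 $ 2 = d"
  by (simp_all add: mat22_def)

lemma mat22_eq_iff: "A = B \<longleftrightarrow> A $ 1 $ 1 = B $ 1 $ 1 \<and> A $ 1 $ 2 = B $ 1 $ 2 \<and>
    A $ 2 $ 1 = B $ 2 $ 1 \<and> A $ 2 $ 2 = B $ 2 $ 2" for A B :: "'a^2^2"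
  by (auto simp: vec_eq_iff forall_2)

lemma mat22_simps:
  fixes a b c d a' b' c' d' :: complex
  shows "mat22 a b c d ** mat22 a' b' c' d' =
      mat22 (a * a' + b * c') (a * b' + b * d') (c * a' + d * c') (c * b' + d * d')"
    and "conj_mat (mat22 a b c d) = mat22 (cnj a) (cnj b) (cnj c) (cnj d)"
    and "transpose (mat22 a b c d) = mat22 a c b d"
    and "mat a = mat22 a 0 0 a"
    and "r *\<^sub>R mat22 a b c d = mat22 (r *\<^sub>R a) (r *\<^sub>R b) (r *\<^sub>R c) (r *\<^sub>R d)"
    and "mat22 a b c d - mat22 a' b' c' d' = mat22 (a - a') (b - b') (c - c') (d - d')"
    and "- mat22 a b c d = mat22 (- a) (- b) (- c) (- d)"
  by (simp_all add: mat22_eq_iff matrix_matrix_mult_def sum_2 transpose_def mat_def)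

text \<open>The node \<open>s\<close> acts on the sphere by \<open>z \<mapsto> M (cnj z)\<close> with \<open>M = refl_mat s\<close>; the last branch, the plain
  conjugation, belongs to node 2.\<close>

definition refl_mat :: "int \<Rightarrow> complex^2^2" where
  "refl_mat s =
    (if s = -1 then mat22 0 1 1 0
     else if s = 0 then mat22 (-1) 1 0 1
     else if s = 1 then mat22 \<i> 0 0 1
     else mat 1)"

text \<open>The linear part of the composition of semilinear maps along a word: each letter conjugates whatever
  stands to its right.\<close>

definition word_mat :: "int list \<Rightarrow> complex^2^2" where
  "word_mat w = foldr (\<lambda>s A. refl_mat s ** conj_mat A) w (mat 1)"

lemma word_mat_simps [simp]:
  "word_mat [] = mat 1"
  "word_mat (s # w) = refl_mat s ** conj_mat (word_mat w)"
  by (simp_all add: word_mat_def)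

lemma word_mat_append: "word_mat (u @ v) = word_mat u ** (conj_mat ^^ length u) (word_mat v)"
  by (induction u) (simp_all add: conj_mat_mult matrix_mul_assoc)

definition gauss_units :: "complex set" where
  "gauss_units = {1, -1, \<i>, -\<i>}"

lemma gauss_units_mult: "c \<in> gauss_units \<Longrightarrow> d \<in> gauss_units \<Longrightarrow> c * d \<in> gauss_units"
  and gauss_units_cnj: "c \<in> gauss_units \<Longrightarrow> cnj c \<in> gauss_units"
  and gauss_units_mult_cnj: "c \<in> gauss_units \<Longrightarrow> c * cnj c = 1"
  and gauss_units_one: "1 \<in> gauss_units"
  by (auto simp: gauss_units_def)

definition unit_multiple :: "complex^2^2 \<Rightarrow> complex^2^2 \<Rightarrow> bool" where
  "unit_multiple A B \<longleftrightarrow> (\<exists>c\<in>gauss_units. A = mat c ** B)"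

lemma mat_mult: "mat a ** mat b = (mat (a * b) :: complex^2^2)"
  by (simp add: mat22_simps)

lemma mat_commute: "mat a ** A = A ** mat a" for A :: "complex^2^2"
  by (simp add: mat22_eq_iff matrix_matrix_mult_def sum_2 mat_def)

lemma unit_multiple_refl: "unit_multiple A A"
  using gauss_units_one by (force simp: unit_multiple_def)

lemma unit_multiple_sym:
  assumes "unit_multiple A B"
  shows "unit_multiple B A"
proof -
  obtain c where c: "c \<in> gauss_units" "A = mat c ** B" using assms by (auto simp: unit_multiple_def)
  then have "B = mat (cnj c) ** A"
    using gauss_units_mult_cnj[OF c(1)] by (simp add: matrix_mul_assoc mat_mult mult.commute)
  then show ?thesis using gauss_units_cnj[OF c(1)] by (auto simp: unit_multiple_def)
qed

lemma unit_multiple_trans: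
  assumes "unit_multiple A B" "unit_multiple B C"
  shows "unit_multiple A C"
  using assms unfolding unit_multiple_def
  by (metis gauss_units_mult matrix_mul_assoc mat_mult)

lemma unit_multiple_mult:
  assumes "unit_multiple A A'" "unit_multiple B B'"
  shows "unit_multiple (A ** B) (A' ** B')"
proof -
  obtain c d where c: "c \<in> gauss_units" "A = mat c ** A'" and d: "d \<in> gauss_units" "B = mat d ** B'"
    using assms unfolding unit_multiple_def by blast
  have "A ** B = mat c ** (A' ** mat d) ** B'" by (simp add: c d matrix_mul_assoc)
  also have "A' ** mat d = mat d ** A'" by (rule mat_commute[symmetric])
  also have "mat c ** (mat d ** A') ** B' = mat (c * d) ** (A' ** B')"
    by (simp add: matrix_mul_assoc mat_mult)
  finally show ?thesis using c d gauss_units_mult by (auto simp: unit_multiple_def)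
qed

lemma unit_multiple_conj_mat: "unit_multiple A B \<Longrightarrow> unit_multiple (conj_mat A) (conj_mat B)"
  by (auto simp: unit_multiple_def conj_mat_mult intro: gauss_units_cnj)

text \<open>The data of a word that depend only on its image in the Weyl group; by \<open>weyl_elt_eq_iff\<close> they
  also determine that image.\<close>

definition same_image :: "int list \<Rightarrow> int list \<Rightarrow> bool" where
  "same_image u v \<longleftrightarrow> (even (length u) \<longleftrightarrow> even (length v)) \<and>
    (even (count_list u 1) \<longleftrightarrow> even (count_list v 1)) \<and> unit_multiple (word_mat u) (word_mat v)"

lemma same_image_equivp: "equivp same_image"
  by (rule equivpI)
    (auto simp: same_image_def reflp_def symp_def transp_def
      intro: unit_multiple_refl unit_multiple_sym unit_multiple_trans)

text \<open>Only the parity of the length of \<open>u\<close> decides whether the matrix of \<open>v\<close> gets conjugated.\<close>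

lemma same_image_append:
  assumes "same_image u u'" "same_image v v'"
  shows "same_image (u @ v) (u' @ v')"
  using assms
  by (auto simp: same_image_def word_mat_append conj_mat_pow_apply
      intro!: unit_multiple_mult unit_multiple_conj_mat)

lemma same_image_sq: "s \<in> C2pp_nodes \<Longrightarrow> same_image [s, s] []"
  by (auto simp: C2pp_nodes_def same_image_def unit_multiple_def gauss_units_def refl_mat_def
      mat22_simps mat22_eq_iff)

lemma C2pp_exponent_enat:
  assumes "s \<in> C2pp_nodes" "t \<in> C2pp_nodes" "s \<noteq> t"
  shows "weyl_exponent C2pp_cartan s t =
    enat (if {s, t} = {-1, 0} then 3 else if {s, t} = {0, 1} \<or> {s, t} = {1, 2} then 4 else 2)"
  unfolding C2pp_exponents[OF assms] numeral_eq_enat by (simp only: if_distrib[of enat])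

lemma word_mat_replicate:
  assumes "even (length w)"
  shows "word_mat (concat (replicate k w)) = (((**) (word_mat w)) ^^ k) (mat 1)"
  using assms by (induction k) (simp_all add: word_mat_append conj_mat_pow_apply)

lemma count_list_replicate: "count_list (concat (replicate k w)) x = k * count_list w x"
  by (induction k) simp_all

text \<open>For adjacent nodes \<open>s, t\<close> the holomorphic map \<open>s t\<close> is a rotation of order 3 or 4, otherwise of order 2; the power
  of its matrix is a unit scalar and in general not the identity.\<close>

lemma same_image_braid:
  assumes "s \<in> C2pp_nodes" "t \<in> C2pp_nodes" "s \<noteq> t" "weyl_exponent C2pp_cartan s t = enat k"
  shows "same_image (concat (replicate k [s, t])) []"
proof -
  have k: "k = (if {s, t} = {-1, 0} then 3 else if {s, t} = {0, 1} \<or> {s, t} = {1, 2} then 4 else 2)"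
    using assms(4) unfolding C2pp_exponent_enat[OF assms(1-3)] enat.inject ..
  have "even (k * count_list [s, t] 1)"
    using assms(1-3) unfolding C2pp_nodes_def
    by (elim insertE emptyE; simp add: k doubleton_eq_iff)
  moreover have "\<exists>c\<in>gauss_units. (((**) (refl_mat s ** conj_mat (refl_mat t))) ^^ k) (mat 1) = mat c"
    using assms(1-3) unfolding C2pp_nodes_def
    by (elim insertE emptyE, simp_all only: k, simp_all add: refl_mat_def mat22_simps,
        simp_all add: doubleton_eq_iff, simp_all add: numeral_eq_Suc gauss_units_def,
        simp_all add: mat22_simps, simp_all add: mat22_eq_iff, simp_all add: complex_eq_iff)
  ultimately show ?thesis
    using word_mat_replicate[of "[s, t]" k]
    by (simp add: same_image_def unit_multiple_def count_list_replicate mult.commute length_concat sum_list_replicate)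
qed

text \<open>The action on binary Hermitian forms. It is defined on all matrices, which saves a subtype; the
  roots are Hermitian.\<close>

definition herm_act :: "int \<Rightarrow> complex^2^2 \<Rightarrow> complex^2^2" where
  "herm_act s X = refl_mat s ** conj_mat X ** transpose (conj_mat (refl_mat s))"

lemma foldr_herm_act:
  "foldr herm_act w X = word_mat w ** (conj_mat ^^ length w) X ** transpose (conj_mat (word_mat w))"
  by (induction w)
    (simp_all add: herm_act_def conj_mat_mult matrix_transpose_mul matrix_mul_assoc conj_mat_transpose transpose_mat)

lemma herm_act_linear: "linear (herm_act s)"
  by (rule linearI) (simp_all add: herm_act_def mat22_eq_iff matrix_matrix_mult_def sum_2 transpose_def algebra_simps)

text \<open>A unit \<open>c\<close> in front of the matrix contributes the factor \<open>c * cnj c = 1\<close>.\<close>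

lemma foldr_herm_act_cong:
  assumes "same_image u v"
  shows "foldr herm_act u = foldr herm_act v"
proof
  fix X :: "complex^2^2"
  obtain c where c: "c * cnj c = 1" "word_mat u = mat c ** word_mat v"
    using assms gauss_units_mult_cnj unfolding same_image_def unit_multiple_def by blast
  let ?X = "(conj_mat ^^ length v) X"
  have "(conj_mat ^^ length u) X = ?X"
    using assms by (simp add: same_image_def conj_mat_pow_apply)
  then have "foldr herm_act u X =
      mat c ** ((word_mat v ** ?X ** transpose (conj_mat (word_mat v))) ** mat (cnj c))"
    by (simp add: foldr_herm_act c(2) conj_mat_mult matrix_transpose_mul matrix_mul_assoc transpose_mat)
  also have "\<dots> = mat (c * cnj c) ** (word_mat v ** ?X ** transpose (conj_mat (word_mat v)))"
    by (subst mat_commute[symmetric]) (simp add: matrix_mul_assoc mat_mult)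
  finally show "foldr herm_act u X = foldr herm_act v X"
    by (simp add: c(1) foldr_herm_act)
qed

text \<open>Generators of the \<open>-1\<close>-eigenspaces of the four reflections on Hermitian matrices. Signs and lengths
  are chosen so that the off-diagonal coefficients in \<open>herm_act_root\<close> are those of the Cartan matrix.\<close>

definition herm_root :: "int \<Rightarrow> complex^2^2" where
  "herm_root s =
    (if s = -1 then mat22 (-1) 0 0 1
     else if s = 0 then mat22 1 1 1 0
     else if s = 1 then mat22 0 ((-1 + \<i>) / 2) ((-1 - \<i>) / 2) 0
     else mat22 0 (-\<i>) \<i> 0)"

lemma herm_act_root:
  assumes "s \<in> C2pp_nodes" "t \<in> C2pp_nodes"
  shows "herm_act s (herm_root t) = herm_root t - real_of_int (C2pp_cartan s t) *\<^sub>R herm_root s"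
  using assms unfolding C2pp_nodes_def
  by (elim insertE emptyE; simp add: herm_act_def herm_root_def refl_mat_def C2pp_cartan_def;
      simp add: mat22_simps; simp add: mat22_eq_iff complex_eq_iff)

lemma herm_act_self: "s \<in> C2pp_nodes \<Longrightarrow> herm_act s (herm_root s) = - herm_root s"
  by (simp add: herm_act_root C2pp_cartan_def scaleR_2)

text \<open>Among Hermitian matrices these are the nonnegative combinations of the four roots: the coordinates
  of \<open>X\<close> in the root basis are, up to a factor 2 in the third, the four quantities that are required
  to be nonnegative.\<close>

definition pos_cone :: "(complex^2^2) set" where
  "pos_cone = {X. 0 \<le> Re (X $ 2 $ 2) \<and> 0 \<le> Re (X $ 1 $ 1 + X $ 2 $ 2) \<and>
     0 \<le> Re (X $ 1 $ 1 + X $ 2 $ 2 - X $ 1 $ 2) \<and>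
     Im (X $ 1 $ 2) \<le> Re (X $ 1 $ 1 + X $ 2 $ 2 - X $ 1 $ 2)}"

lemma pos_cone_closed:
  assumes X: "X \<in> pos_cone" and Y: "Y \<in> pos_cone" and ab: "0 \<le> a" "0 \<le> b"
  shows "a *\<^sub>R X + b *\<^sub>R Y \<in> pos_cone"
proof -
  have comb: "0 \<le> a * x + b * y" if "0 \<le> x" "0 \<le> y" for x y using that ab by simp
  show ?thesis
    using X Y comb[of "Re (X $ 2 $ 2)" "Re (Y $ 2 $ 2)"]
      comb[of "Re (X $ 1 $ 1) + Re (X $ 2 $ 2)" "Re (Y $ 1 $ 1) + Re (Y $ 2 $ 2)"]
      comb[of "Re (X $ 1 $ 1) + Re (X $ 2 $ 2) - Re (X $ 1 $ 2)"
        "Re (Y $ 1 $ 1) + Re (Y $ 2 $ 2) - Re (Y $ 1 $ 2)"]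
      comb[of "Re (X $ 1 $ 1) + Re (X $ 2 $ 2) - Re (X $ 1 $ 2) - Im (X $ 1 $ 2)"
        "Re (Y $ 1 $ 1) + Re (Y $ 2 $ 2) - Re (Y $ 1 $ 2) - Im (Y $ 1 $ 2)"]
    unfolding pos_cone_def by (simp add: algebra_simps)
qed

lemma herm_root_pos: "s \<in> C2pp_nodes \<Longrightarrow> herm_root s \<in> pos_cone"
  and neg_herm_root: "s \<in> C2pp_nodes \<Longrightarrow> - herm_root s \<notin> pos_cone"
  by (auto simp: C2pp_nodes_def herm_root_def pos_cone_def)

text \<open>With \<open>p\<close> and \<open>q\<close> the two off-diagonal entries of the Cartan matrix, the words \<open>t\<close>, \<open>s t\<close> and \<open>t s t\<close> send
  the root of \<open>s\<close> to combinations with coefficients \<open>1, -p\<close>, then \<open>p q - 1, -p\<close>, then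
  \<open>p q - 1, -p (p q - 2)\<close>. Lengths 2 and 3 only occur when \<open>p q \<ge> 1\<close> and \<open>p q \<ge> 2\<close>.\<close>

lemma herm_rank_two:
  assumes s: "s \<in> C2pp_nodes" and t: "t \<in> C2pp_nodes" and "s \<noteq> t"
    and j: "enat j < weyl_exponent C2pp_cartan s t"
  shows "\<exists>a\<ge>0. \<exists>b\<ge>0.
    foldr herm_act (rev (alternating t s j)) (herm_root s) = a *\<^sub>R herm_root s + b *\<^sub>R herm_root t"
proof -
  define p q where "p = real_of_int (C2pp_cartan t s)" and "q = real_of_int (C2pp_cartan s t)"
  have "j < (if {s, t} = {-1, 0} then 3 else if {s, t} = {0, 1} \<or> {s, t} = {1, 2} then 4 else 2)"
    using j unfolding C2pp_exponent_enat[OF assms(1-3)] enat_ord_simps .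
  then have bounds: "p \<le> 0" "j \<in> {0, 1, 2, 3}" "j \<ge> 2 \<Longrightarrow> p * q \<ge> 1" "j \<ge> 3 \<Longrightarrow> p * q \<ge> 2"
    using assms(1-3) unfolding C2pp_nodes_def p_def q_def
    by (elim insertE emptyE; force simp: C2pp_cartan_def doubleton_eq_iff)+
  interpret ls: linear "herm_act s" by (rule herm_act_linear)
  interpret lt: linear "herm_act t" by (rule herm_act_linear)
  have act: "herm_act s (herm_root s) = - herm_root s" "herm_act t (herm_root t) = - herm_root t"
    "herm_act s (herm_root t) = herm_root t - q *\<^sub>R herm_root s"
    "herm_act t (herm_root s) = herm_root s - p *\<^sub>R herm_root t"
    unfolding p_def q_def by (intro herm_act_root herm_act_self s t)+
  have one: "foldr herm_act [t] (herm_root s) = 1 *\<^sub>R herm_root s + (- p) *\<^sub>R herm_root t"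
    by (simp add: act)
  have two: "foldr herm_act [s, t] (herm_root s) = (p * q - 1) *\<^sub>R herm_root s + (- p) *\<^sub>R herm_root t"
    by (simp add: act ls.diff ls.scale algebra_simps)
  have comb: "r *\<^sub>R (x - p *\<^sub>R y) + (- p) *\<^sub>R (- y) = r *\<^sub>R x + (p - r * p) *\<^sub>R y"
    for r and x y :: "complex^2^2"
    by (simp add: scaleR_right_diff_distrib scaleR_left_diff_distrib)
  have three: "foldr herm_act [t, s, t] (herm_root s) =
      (p * q - 1) *\<^sub>R herm_root s + (- p * (p * q - 2)) *\<^sub>R herm_root t"
  proof -
    have "foldr herm_act [t, s, t] (herm_root s) = herm_act t (foldr herm_act [s, t] (herm_root s))"
      by simp
    also have "\<dots> = (p * q - 1) *\<^sub>R (herm_root s - p *\<^sub>R herm_root t) + (- p) *\<^sub>R (- herm_root t)"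
      unfolding two by (simp only: lt.add lt.scale act)
    also have "\<dots> = (p * q - 1) *\<^sub>R herm_root s + (p - (p * q - 1) * p) *\<^sub>R herm_root t"
      by (rule comb)
    also have "p - (p * q - 1) * p = - p * (p * q - 2)" by (simp add: algebra_simps)
    finally show ?thesis .
  qed
  consider "j = 0" | "j = 1" | "j = 2" | "j = 3" using bounds(2) by auto
  then show ?thesis
  proof cases
    case 1
    then show ?thesis by (intro exI[of _ 1] conjI exI[of _ 0]) simp_all
  next
    case 2
    then have "rev (alternating t s j) = [t]" by simp
    with one bounds(1) show ?thesis by (metis neg_0_le_iff_le zero_le_one)
  next
    case 3
    then have "rev (alternating t s j) = [s, t]" by (simp add: numeral_eq_Suc)
    moreover have "0 \<le> p * q - 1" "0 \<le> - p" using bounds 3 by auto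
    ultimately show ?thesis using two by metis
  next
    case 4
    then have "rev (alternating t s j) = [t, s, t]" by (simp add: numeral_eq_Suc)
    moreover have "0 \<le> p * q - 1" "0 \<le> - p * (p * q - 2)"
      using bounds 4 by (auto intro: mult_nonpos_nonneg)
    ultimately show ?thesis using three by metis
  qed
qed

section \<open>The word problem of the Weyl group\<close>

abbreviation W :: "int gword set monoid" where
  "W \<equiv> weyl_group C2pp_nodes C2pp_cartan"

abbreviation weyl_elt :: "int list \<Rightarrow> int gword set" where
  "weyl_elt \<equiv> word_prod W (weyl_gen C2pp_nodes C2pp_cartan)"

lemma weyl_gen_eq_coxeter_gen: "weyl_gen I A = coxeter_gen I (weyl_exponent A)"
  by (rule ext) (simp only: weyl_gen_def)

lemma weyl_elt_eq_imp_same_image: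
  assumes "u \<in> lists C2pp_nodes" "v \<in> lists C2pp_nodes" "weyl_elt u = weyl_elt v"
  shows "same_image u v"
proof (rule coxeter_elt_eq_imp[OF same_image_equivp])
  show "same_image (a @ b) (a' @ b')" if "same_image a a'" "same_image b b'" for a a' b b'
    by (rule same_image_append[OF that])
  show "coxeter_elt C2pp_nodes (weyl_exponent C2pp_cartan) u =
      coxeter_elt C2pp_nodes (weyl_exponent C2pp_cartan) v"
    using assms(3) unfolding weyl_group_def weyl_gen_eq_coxeter_gen .
qed (fact same_image_sq same_image_braid assms)+

interpretation W: root_positivity W C2pp_nodes "weyl_exponent C2pp_cartan"
  "weyl_gen C2pp_nodes C2pp_cartan" herm_act herm_root pos_cone
proof (intro root_positivity.intro root_positivity_axioms.intro)
  show "group W" unfolding weyl_group_def by (rule coxeter_group_is_group)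
  show "weyl_exponent C2pp_cartan s t = weyl_exponent C2pp_cartan t s" for s t
    by (simp add: weyl_exponent_def mult.commute)
  show "weyl_exponent C2pp_cartan s t \<noteq> 0" for s t
    by (simp add: weyl_exponent_def Let_def)
  show "weyl_gen C2pp_nodes C2pp_cartan s \<in> carrier W" if "s \<in> C2pp_nodes" for s
    unfolding weyl_group_def weyl_gen_def by (rule coxeter_gen_closed[OF that])
  show "weyl_gen C2pp_nodes C2pp_cartan s \<otimes>\<^bsub>W\<^esub> weyl_gen C2pp_nodes C2pp_cartan s = \<one>\<^bsub>W\<^esub>"
    if "s \<in> C2pp_nodes" for s
    unfolding weyl_group_def weyl_gen_def by (rule coxeter_gen_sq[OF that])
  show "weyl_elt (concat (replicate k [s, t])) = \<one>\<^bsub>W\<^esub>"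
    if "s \<in> C2pp_nodes" "t \<in> C2pp_nodes" "s \<noteq> t" "weyl_exponent C2pp_cartan s t = enat k" for s t k
    unfolding weyl_group_def weyl_gen_eq_coxeter_gen by (rule coxeter_braid[where m = "weyl_exponent C2pp_cartan", OF that])
  show "linear (herm_act s)" for s by (rule herm_act_linear)
  show "foldr herm_act u = foldr herm_act v"
    if "u \<in> lists C2pp_nodes" "v \<in> lists C2pp_nodes" "weyl_elt u = weyl_elt v" for u v
    by (rule foldr_herm_act_cong[OF weyl_elt_eq_imp_same_image[OF that]])
qed (fact herm_act_self pos_cone_closed herm_root_pos neg_herm_root herm_rank_two)+

text \<open>If \<open>u\<close> and \<open>v\<close> have the same image, then \<open>v\<inverse> u\<close> acts trivially on Hermitian matrices, and
  faithfulness applies to it.\<close>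

lemma weyl_elt_eq_iff:
  assumes u: "u \<in> lists C2pp_nodes" and v: "v \<in> lists C2pp_nodes"
  shows "weyl_elt u = weyl_elt v \<longleftrightarrow> same_image u v"
proof
  assume uv: "same_image u v"
  have rv: "rev v \<in> lists C2pp_nodes" using v by (simp add: rev_in_lists)
  have "weyl_elt (rev v @ v) = \<one>\<^bsub>W\<^esub>"
    using v rv by (simp add: W.elt_append W.elt_rev W.elt_closed)
  then have "foldr herm_act (rev v @ v) = foldr herm_act []"
    by (intro W.act_cong) (use v rv in simp_all)
  moreover have "foldr herm_act (rev v @ u) = foldr herm_act (rev v @ v)"
    using foldr_herm_act_cong[OF uv] by (simp add: fun_eq_iff)
  ultimately have "weyl_elt (rev v @ u) = \<one>\<^bsub>W\<^esub>"
    using u rv by (intro W.faithful) (simp_all del: foldr_append)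
  then have "inv\<^bsub>W\<^esub> (weyl_elt v) \<otimes>\<^bsub>W\<^esub> weyl_elt u = \<one>\<^bsub>W\<^esub>"
    using u v rv by (simp add: W.elt_append W.elt_rev)
  then have "inv\<^bsub>W\<^esub> (weyl_elt u) = inv\<^bsub>W\<^esub> (weyl_elt v)"
    using u v by (intro W.inv_equality) (simp_all add: W.elt_closed)
  then show "weyl_elt u = weyl_elt v"
    using u v by (metis W.elt_closed W.inv_inv)
qed (rule weyl_elt_eq_imp_same_image[OF assms])

section \<open>From even words to cosets in the special linear group\<close>

lemma gaussian_ints_ring:
  "x \<in> gaussian_ints \<Longrightarrow> y \<in> gaussian_ints \<Longrightarrow> x + y \<in> gaussian_ints"
  "x \<in> gaussian_ints \<Longrightarrow> y \<in> gaussian_ints \<Longrightarrow> x - y \<in> gaussian_ints"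
  "x \<in> gaussian_ints \<Longrightarrow> y \<in> gaussian_ints \<Longrightarrow> x * y \<in> gaussian_ints"
  "x \<in> gaussian_ints \<Longrightarrow> - x \<in> gaussian_ints"
  "x \<in> gaussian_ints \<Longrightarrow> cnj x \<in> gaussian_ints"
  by (simp_all add: gaussian_ints_iff)

definition gaussian_mat :: "complex^2^2 \<Rightarrow> bool" where
  "gaussian_mat A \<longleftrightarrow> (\<forall>i j. A $ i $ j \<in> gaussian_ints)"

lemma gaussian_mat_mult: "gaussian_mat A \<Longrightarrow> gaussian_mat B \<Longrightarrow> gaussian_mat (A ** B)"
  by (simp add: gaussian_mat_def matrix_matrix_mult_def sum_2 gaussian_ints_ring)

lemma gaussian_mat_gauss_unit: "c \<in> gauss_units \<Longrightarrow> gaussian_mat (mat c)"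
  by (auto simp: gaussian_mat_def mat_def gauss_units_def gaussian_ints_iff)

lemma SL2Zi_carrier: "A \<in> carrier SL2Zi \<longleftrightarrow> gaussian_mat A \<and> det A = 1"
  by (simp add: SL2Zi_def gaussian_mat_def)

lemma gaussian_word_mat: "gaussian_mat (word_mat w)"
proof (induction w)
  case (Cons s w)
  have "gaussian_mat (refl_mat s)"
    by (simp add: gaussian_mat_def forall_2 refl_mat_def mat_def gaussian_ints_iff)
  moreover have "gaussian_mat (conj_mat (word_mat w))"
    using Cons by (simp add: gaussian_mat_def gaussian_ints_ring)
  ultimately show ?case by (simp add: gaussian_mat_mult)
qed (simp add: gaussian_mat_gauss_unit gauss_units_one)

lemma det_word_mat:
  "det (word_mat w) \<in> (if even (count_list w 1) then {1, -1} else {\<i>, -\<i>})"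
proof (induction w)
  case (Cons s w)
  have "det (conj_mat (word_mat w)) = cnj (det (word_mat w))" by (simp add: det_2)
  moreover have "det (refl_mat s) = (if s = 1 then \<i> else if s \<in> {-1, 0} then -1 else 1)"
    by (simp add: refl_mat_def det_2 mat_def)
  ultimately show ?case using Cons by (auto simp: det_mul split: if_splits)
qed simp

lemma det_mat: "det (mat c :: complex^2^2) = c\<^sup>2"
  by (simp add: det_2 mat_def power2_eq_square)

lemma neg_mat: "mat (-1) ** A = - A" for A :: "complex^2^2"
  by (simp add: mat22_eq_iff matrix_matrix_mult_def sum_2 mat_def)

text \<open>The determinant is \<open>\<plusminus>1\<close>, and multiplying the matrix by \<open>\<i>\<close> changes the sign of the determinant.\<close>

lemma SL2Zi_representative:
  assumes "even (count_list w 1)"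
  obtains A where "A \<in> carrier SL2Zi" "unit_multiple A (word_mat w)"
proof -
  obtain c where c: "c \<in> gauss_units" "c\<^sup>2 * det (word_mat w) = 1"
    using det_word_mat[of w] assms by (force simp: gauss_units_def)
  show thesis
  proof
    show "mat c ** word_mat w \<in> carrier SL2Zi"
      using c by (simp add: SL2Zi_carrier gaussian_mat_mult gaussian_mat_gauss_unit
          gaussian_word_mat det_mul det_mat)
    show "unit_multiple (mat c ** word_mat w) (word_mat w)"
      using c by (auto simp: unit_multiple_def)
  qed
qed

lemma unit_multiple_SL2Zi:
  assumes "A \<in> carrier SL2Zi" "B \<in> carrier SL2Zi" "unit_multiple A B"
  shows "A = B \<or> A = - B"
proof -
  obtain c where c: "c \<in> gauss_units" "A = mat c ** B" using assms by (auto simp: unit_multiple_def)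
  then have "c\<^sup>2 = 1" using assms by (simp add: SL2Zi_carrier det_mul det_mat)
  then show ?thesis using c neg_mat by (auto simp: power2_eq_1_iff)
qed

lemma centre_coset: "{mat 1, - mat 1} #>\<^bsub>SL2Zi\<^esub> A = {A, - A}"
proof -
  have "- mat 1 ** A = - A"
    by (simp add: mat22_eq_iff matrix_matrix_mult_def sum_2 mat_def)
  then show ?thesis by (auto simp: r_coset_def SL2Zi_def)
qed

text \<open>All rescalings of determinant 1 of all matrices of \<open>x\<close>. Collecting them makes the map independent
  of choices; \<open>psl_image_eq\<close> shows that for words with an even number of letters \<open>1\<close> they form a single coset.\<close>

definition psl_image :: "int gword set \<Rightarrow> (complex^2^2) set" where
  "psl_image x =
    {A \<in> carrier SL2Zi. \<exists>w\<in>lists C2pp_nodes. weyl_elt w = x \<and> unit_multiple A (word_mat w)}"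

text \<open>By \<open>weyl_elt_eq_iff\<close>, any word for the same element has the same matrix up to a unit, and the only
  units that keep the determinant equal to 1 are \<open>1\<close> and \<open>-1\<close>.\<close>

lemma psl_image_eq:
  assumes "w \<in> lists C2pp_nodes" "A \<in> carrier SL2Zi" "unit_multiple A (word_mat w)"
  shows "psl_image (weyl_elt w) = {mat 1, - mat 1} #>\<^bsub>SL2Zi\<^esub> A"
  unfolding centre_coset
proof (intro equalityI subsetI)
  fix B assume "B \<in> psl_image (weyl_elt w)"
  then obtain v where v: "B \<in> carrier SL2Zi" "v \<in> lists C2pp_nodes" "weyl_elt v = weyl_elt w"
    "unit_multiple B (word_mat v)" by (auto simp: psl_image_def)
  then have "unit_multiple (word_mat v) (word_mat w)"
    using weyl_elt_eq_iff assms(1) by (simp add: same_image_def)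
  then have "unit_multiple B A"
    using v assms by (blast intro: unit_multiple_trans unit_multiple_sym)
  then show "B \<in> {A, - A}" using unit_multiple_SL2Zi v assms by blast
next
  fix B assume B: "B \<in> {A, - A}"
  then obtain c where "c \<in> gauss_units" "B = mat c ** A" "c\<^sup>2 = 1"
    using neg_mat[of A] by (force simp: gauss_units_def)
  then have "unit_multiple B A" "B \<in> carrier SL2Zi"
    using assms(2) by (auto simp: unit_multiple_def SL2Zi_carrier det_mul det_mat
        gaussian_mat_mult gaussian_mat_gauss_unit)
  then show "B \<in> psl_image (weyl_elt w)"
    using assms by (auto simp: psl_image_def intro: unit_multiple_trans)
qed

section \<open>Surjectivity: the Euclidean algorithm in the Gaussian integers\<close>

definition realised :: "complex^2^2 \<Rightarrow> bool" where
  "realised A \<longleftrightarrow> (\<exists>w\<in>lists C2pp_nodes. even (length w) \<and> even (count_list w 1) \<and>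
     unit_multiple A (word_mat w))"

lemma realised_mult: "realised A \<Longrightarrow> realised B \<Longrightarrow> realised (A ** B)"
  unfolding realised_def
proof (elim bexE conjE)
  fix u v
  assume "u \<in> lists C2pp_nodes" "even (length u)" "even (count_list u 1)"
    "unit_multiple A (word_mat u)" "v \<in> lists C2pp_nodes" "even (length v)"
    "even (count_list v 1)" "unit_multiple B (word_mat v)"
  then show "\<exists>w\<in>lists C2pp_nodes. even (length w) \<and> even (count_list w 1) \<and>
      unit_multiple (A ** B) (word_mat w)"
    by (intro bexI[of _ "u @ v"]) (simp_all add: word_mat_append conj_mat_pow_apply unit_multiple_mult)
qed

lemma realisedI:
  assumes "w \<in> lists C2pp_nodes" "even (length w)" "even (count_list w 1)" "c \<in> gauss_units"
    "A = mat c ** word_mat w"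
  shows "realised A"
  using assms by (auto simp: realised_def unit_multiple_def)

text \<open>The word is \<open>z \<mapsto> 1 / cnj z\<close> after \<open>z \<mapsto> - cnj z\<close>, the latter being the conjugate of node 2 by node 1.\<close>

lemma realised_inversion: "realised (mat22 0 1 (-1) 0)"
  by (rule realisedI[of "[-1, 1, 2, 1]" 1])
    (simp_all add: C2pp_nodes_def gauss_units_def refl_mat_def mat22_simps)

text \<open>The nodes 1 and 2 compose to the rotation \<open>z \<mapsto> \<i> z\<close>, whose square is \<open>z \<mapsto> -z\<close>.\<close>

lemma realised_diag: "u \<in> gauss_units \<Longrightarrow> realised (mat22 u 0 0 (cnj u))"
  unfolding gauss_units_def
proof (elim insertE emptyE)
  show "realised (mat22 u 0 0 (cnj u))" if "u = 1"
    by (rule realisedI[of "[]" 1]) (simp_all add: that gauss_units_def mat22_simps)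
  show "realised (mat22 u 0 0 (cnj u))" if "u = -1"
    by (rule realisedI[of "[]" "-1"]) (simp_all add: that gauss_units_def mat22_simps)
  show "realised (mat22 u 0 0 (cnj u))" if "u = \<i>"
    by (rule realisedI[of "[1, 2, 1, 2]" "-\<i>"])
      (simp_all add: that C2pp_nodes_def gauss_units_def refl_mat_def mat22_simps)
  show "realised (mat22 u 0 0 (cnj u))" if "u = -\<i>"
    by (rule realisedI[of "[1, 2, 1, 2]" "\<i>"])
      (simp_all add: that C2pp_nodes_def gauss_units_def refl_mat_def mat22_simps)
qed

abbreviation translation :: "complex \<Rightarrow> complex^2^2" where
  "translation q \<equiv> mat22 1 q 0 1"

lemma realised_translation_add:
  "realised (translation p) \<Longrightarrow> realised (translation q) \<Longrightarrow> realised (translation (p + q))"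
  using realised_mult[of "translation q" "translation p"] by (simp add: mat22_simps add.commute)

text \<open>The translation by 1 is \<open>z \<mapsto> 1 - cnj z\<close> after \<open>z \<mapsto> - cnj z\<close>. Conjugating by the rotation \<open>z \<mapsto> \<i> z\<close>
  gives the translation by \<open>\<i>\<close>; the conjugating letters come in pairs, so the parity of the letter
  \<open>1\<close> stays even. The negatives are the reversed words.\<close>

lemma realised_translation_gen:
  "realised (translation 1)" "realised (translation (-1))"
  "realised (translation \<i>)" "realised (translation (-\<i>))"
proof -
  show "realised (translation 1)"
    by (rule realisedI[of "[0, 1, 2, 1]" 1])
      (simp_all add: C2pp_nodes_def gauss_units_def refl_mat_def mat22_simps)
  show "realised (translation (-1))"
    by (rule realisedI[of "[1, 2, 1, 0]" 1])
      (simp_all add: C2pp_nodes_def gauss_units_def refl_mat_def mat22_simps)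
  show "realised (translation \<i>)"
    by (rule realisedI[of "[1, 2, 0, 1, 2, 1, 2, 1]" 1])
      (simp_all add: C2pp_nodes_def gauss_units_def refl_mat_def mat22_simps)
  show "realised (translation (-\<i>))"
    by (rule realisedI[of "[1, 2, 1, 2, 1, 0, 2, 1]" 1])
      (simp_all add: C2pp_nodes_def gauss_units_def refl_mat_def mat22_simps)
qed

lemma realised_translation:
  assumes "q \<in> gaussian_ints"
  shows "realised (translation q)"
proof -
  have mult: "realised (translation (of_int n * p))"
    if "realised (translation p)" "realised (translation (- p))" for n p
  proof (induction n rule: int_induct[where k = 0])
    case base
    show ?case using realised_diag[of 1] by (simp add: gauss_units_one)
  next
    case (step1 n)
    then show ?case using realised_translation_add[OF step1(2) that(1)] by (simp add: algebra_simps)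
  next
    case (step2 n)
    then show ?case using realised_translation_add[OF step2(2) that(2)] by (simp add: algebra_simps)
  qed
  obtain a b where q: "q = of_int a * 1 + of_int b * \<i>"
    using assms by (auto simp: gaussian_ints_def mult.commute)
  show ?thesis
    unfolding q by (intro realised_translation_add mult realised_translation_gen)
qed

lemma gaussian_norm_int:
  assumes "z \<in> gaussian_ints"
  obtains n :: nat where "(cmod z)\<^sup>2 = real n"
proof -
  obtain a b where "z = of_int a + \<i> * of_int b" using assms by (auto simp: gaussian_ints_def)
  then have "(cmod z)\<^sup>2 = real (nat (a\<^sup>2 + b\<^sup>2))" by (simp add: cmod_power2)
  then show thesis by (rule that)
qed

text \<open>Rounding both coordinates of \<open>a / c\<close> leaves an error of squared norm at most \<open>1/2\<close>.\<close>

lemma gaussian_division: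
  assumes "c \<noteq> 0"
  obtains q where "q \<in> gaussian_ints" "cmod (a - q * c) < cmod c"
proof -
  define q where "q = of_int (round (Re (a / c))) + \<i> * of_int (round (Im (a / c)))"
  have bound: "(x - of_int (round x))\<^sup>2 \<le> 1 / 4" for x :: real
  proof -
    have "\<bar>x - of_int (round x)\<bar> \<le> 1 / 2"
      using of_int_round_abs_le[of x] by (simp add: abs_minus_commute)
    then have "\<bar>x - of_int (round x)\<bar>\<^sup>2 \<le> (1 / 2)\<^sup>2" by (intro power_mono) simp_all
    then show ?thesis by (simp add: power2_eq_square)
  qed
  have "(cmod (a / c - q))\<^sup>2 \<le> 1 / 4 + 1 / 4"
    unfolding cmod_power2 by (intro add_mono) (use bound in \<open>simp_all add: q_def\<close>)
  then have "(cmod (a / c - q))\<^sup>2 < 1\<^sup>2" by simp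
  then have "cmod (a / c - q) < 1" by (rule power_less_imp_less_base) simp
  moreover have "a - q * c = (a / c - q) * c" using assms by (simp add: field_simps)
  ultimately have "cmod (a - q * c) < cmod c" using assms by (simp add: norm_mult)
  moreover have "q \<in> gaussian_ints" by (auto simp: q_def gaussian_ints_def)
  ultimately show thesis by (rule that[rotated])
qed

lemma gaussian_unit:
  assumes "a \<in> gaussian_ints" "d \<in> gaussian_ints" "a * d = 1"
  shows "a \<in> gauss_units"
proof -
  obtain x y where a: "a = of_int x + \<i> * of_int y" using assms by (auto simp: gaussian_ints_def)
  obtain n m where nm: "(cmod a)\<^sup>2 = real n" "(cmod d)\<^sup>2 = real m"
    using gaussian_norm_int assms by metis
  have "real n * real m = (cmod (a * d))\<^sup>2" by (simp add: norm_mult power_mult_distrib nm)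
  then have "n * m = 1" using assms(3) by (simp flip: of_nat_mult)
  then have "(cmod a)\<^sup>2 = 1" using nm by simp
  then have "real_of_int (x\<^sup>2 + y\<^sup>2) = 1" by (simp add: a cmod_power2)
  then have xy: "x\<^sup>2 + y\<^sup>2 = 1" by linarith
  then have "x\<^sup>2 \<le> 1" "y\<^sup>2 \<le> 1" by (smt (verit) zero_le_power2)+
  then have "\<bar>x\<bar> \<le> 1" "\<bar>y\<bar> \<le> 1" by (simp_all add: abs_square_le_1)
  then have "x \<in> {-1, 0, 1}" "y \<in> {-1, 0, 1}" by auto
  then show ?thesis using xy by (auto simp: a gauss_units_def)
qed

text \<open>The Euclidean algorithm on the first column: a translation followed by the inversion replaces the
  lower left entry \<open>c\<close> by the remainder of \<open>a\<close> modulo \<open>c\<close>, whose norm is smaller. Once that entry is 0, the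
  matrix is a product of a diagonal one and a translation.\<close>

lemma SL2Zi_realised:
  assumes "A \<in> carrier SL2Zi" "(cmod (A $ 2 $ 1))\<^sup>2 < real n"
  shows "realised A"
  using assms
proof (induction n arbitrary: A)
  case (Suc n)
  define a b c d where abcd: "a = A $ 1 $ 1" "b = A $ 1 $ 2" "c = A $ 2 $ 1" "d = A $ 2 $ 2"
  have A: "A = mat22 a b c d" by (simp add: mat22_eq_iff abcd)
  have gauss: "a \<in> gaussian_ints" "b \<in> gaussian_ints" "c \<in> gaussian_ints" "d \<in> gaussian_ints"
    and det: "a * d - b * c = 1"
    using Suc.prems(1) by (simp_all add: SL2Zi_carrier gaussian_mat_def abcd det_2)
  show ?case
  proof (cases "c = 0")
    case True
    then have "a * d = 1" using det by simp
    then have a: "a \<in> gauss_units" using gaussian_unit gauss by blast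
    then have "d = cnj a" using gauss_units_mult_cnj[OF a] \<open>a * d = 1\<close>
      by (metis mult_cancel_left mult_zero_left zero_neq_one)
    then have "A = mat22 a 0 0 (cnj a) ** translation (d * b)"
      using True \<open>a * d = 1\<close> by (simp add: A mat22_simps flip: mult.assoc)
    then show ?thesis
      using realised_mult realised_diag[OF a] realised_translation gauss gaussian_ints_ring by metis
  next
    case False
    then obtain q where q: "q \<in> gaussian_ints" "cmod (a - q * c) < cmod c"
      using gaussian_division by blast
    define B where "B = mat22 (- c) (- d) (a - q * c) (b - q * d)"
    have B: "B \<in> carrier SL2Zi"
      using gauss q(1) det
      by (simp add: B_def SL2Zi_carrier gaussian_mat_def forall_2 gaussian_ints_ring det_2 algebra_simps)
    obtain k where k: "(cmod (a - q * c))\<^sup>2 = real k"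
      using gaussian_norm_int gauss q(1) gaussian_ints_ring by metis
    obtain l where l: "(cmod c)\<^sup>2 = real l" using gaussian_norm_int gauss by blast
    have "real k < real l"
      unfolding k[symmetric] l[symmetric] using q(2) by (intro power_strict_mono) simp_all
    moreover have "real l < real (Suc n)" using Suc.prems(2) l by (simp add: abcd)
    ultimately have "(cmod (B $ 2 $ 1))\<^sup>2 < real n" using k by (simp add: B_def)
    then have "realised B" using Suc.IH B by blast
    moreover have "A = translation q ** mat22 0 1 (-1) 0 ** B"
      by (simp add: A B_def mat22_simps)
    ultimately show ?thesis
      using realised_mult realised_translation[OF q(1)] realised_inversion by metis
  qed
qed simp

section \<open>The even Weyl group as a semidirect product\<close>

abbreviation Wplus :: "int gword set monoid" where
  "Wplus \<equiv> even_weyl_group C2pp_nodes C2pp_cartan"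

lemma Wplus_carrier: "carrier Wplus = {weyl_elt w | w. w \<in> lists C2pp_nodes \<and> even (length w)}"
  unfolding even_weyl_group_def word_prod_def by simp

lemma Wplus_mult: "x \<otimes>\<^bsub>Wplus\<^esub> y = x \<otimes>\<^bsub>W\<^esub> y"
  by (simp add: even_weyl_group_def)

lemma Wplus_group: "group Wplus"
proof -
  let ?E = "{weyl_elt w | w. w \<in> lists C2pp_nodes \<and> even (length w)}"
  have "subgroup ?E W"
  proof (rule W.subgroupI)
    show "?E \<subseteq> carrier W" using W.elt_closed by blast
    show "?E \<noteq> {}" by (auto intro: exI[of _ "[]"])
    show "inv\<^bsub>W\<^esub> x \<in> ?E" if x: "x \<in> ?E" for x
    proof -
      obtain w where w: "w \<in> lists C2pp_nodes" "even (length w)" "x = weyl_elt w" using x by blast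
      then have "inv\<^bsub>W\<^esub> x = weyl_elt (rev w)" "rev w \<in> lists C2pp_nodes" "even (length (rev w))"
        by (simp_all add: W.elt_rev rev_in_lists)
      then show ?thesis by blast
    qed
    show "x \<otimes>\<^bsub>W\<^esub> y \<in> ?E" if xy: "x \<in> ?E" "y \<in> ?E" for x y
    proof -
      obtain u v where uv: "u \<in> lists C2pp_nodes" "even (length u)" "x = weyl_elt u"
        "v \<in> lists C2pp_nodes" "even (length v)" "y = weyl_elt v" using xy by blast
      then have "x \<otimes>\<^bsub>W\<^esub> y = weyl_elt (u @ v)" "u @ v \<in> lists C2pp_nodes" "even (length (u @ v))"
        by (simp_all add: W.elt_append)
      then show ?thesis by blast
    qed
  qed
  from W.subgroup_imp_group[OF this] show ?thesis
    unfolding even_weyl_group_def word_prod_def .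
qed

text \<open>A property of the group element although it refers to a word: by \<open>odd_parity_weyl_elt\<close> all words for
  \<open>x\<close> agree.\<close>

definition odd_parity :: "int gword set \<Rightarrow> bool" where
  "odd_parity x \<longleftrightarrow> (\<exists>w\<in>lists C2pp_nodes. weyl_elt w = x \<and> odd (count_list w 1))"

lemma odd_parity_weyl_elt:
  assumes "w \<in> lists C2pp_nodes"
  shows "odd_parity (weyl_elt w) \<longleftrightarrow> odd (count_list w 1)"
proof
  assume "odd_parity (weyl_elt w)"
  then obtain v where "v \<in> lists C2pp_nodes" "weyl_elt v = weyl_elt w" "odd (count_list v 1)"
    unfolding odd_parity_def by blast
  then show "odd (count_list w 1)"
    using weyl_elt_eq_imp_same_image[of v w] assms by (simp add: same_image_def)
qed (use assms in \<open>auto simp: odd_parity_def\<close>)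

text \<open>Injectivity is the solution of the word problem, surjectivity the Euclidean algorithm.\<close>

theorem even_parity_iso_PSL2Zi:
  "Wplus\<lparr>carrier := {x \<in> carrier Wplus. \<not> odd_parity x}\<rparr> \<cong> PSL2Zi"
proof (rule is_isoI, unfold iso_def, intro CollectI conjI)
  let ?N = "{x \<in> carrier Wplus. \<not> odd_parity x}"
  let ?Z = "{mat 1, - mat 1} :: (complex^2^2) set"
  interpret Z: normal ?Z SL2Zi by (rule center_normal_SL2Zi)
  have N: "\<exists>w A. w \<in> lists C2pp_nodes \<and> even (length w) \<and> even (count_list w 1) \<and> x = weyl_elt w \<and>
      A \<in> carrier SL2Zi \<and> unit_multiple A (word_mat w) \<and> psl_image x = ?Z #>\<^bsub>SL2Zi\<^esub> A"
    if x: "x \<in> ?N" for x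
  proof -
    obtain w where w: "w \<in> lists C2pp_nodes" "even (length w)" "x = weyl_elt w"
      using x unfolding Wplus_carrier by blast
    then have even: "even (count_list w 1)" using x odd_parity_weyl_elt by blast
    obtain A where A: "A \<in> carrier SL2Zi" "unit_multiple A (word_mat w)"
      using SL2Zi_representative[OF even] .
    with w even psl_image_eq[OF w(1) A] show ?thesis by blast
  qed
  have in_PSL: "?Z #>\<^bsub>SL2Zi\<^esub> A \<in> carrier PSL2Zi" if "A \<in> carrier SL2Zi" for A
    using that by (auto simp: PSL2Zi_def FactGroup_def RCOSETS_def)
  show "psl_image \<in> hom (Wplus\<lparr>carrier := ?N\<rparr>) PSL2Zi"
  proof (rule homI)
    fix x assume "x \<in> carrier (Wplus\<lparr>carrier := ?N\<rparr>)"
    then have "x \<in> ?N" by simp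
    from N[OF this] show "psl_image x \<in> carrier PSL2Zi" using in_PSL by auto
  next
    fix x y
    assume "x \<in> carrier (Wplus\<lparr>carrier := ?N\<rparr>)" "y \<in> carrier (Wplus\<lparr>carrier := ?N\<rparr>)"
    then have x: "x \<in> ?N" and y: "y \<in> ?N" by simp_all
    obtain u A where u: "u \<in> lists C2pp_nodes" "even (length u)" "x = weyl_elt u"
      and A: "A \<in> carrier SL2Zi" "unit_multiple A (word_mat u)" "psl_image x = ?Z #>\<^bsub>SL2Zi\<^esub> A"
      using N[OF x] by blast
    obtain v B where v: "v \<in> lists C2pp_nodes" "y = weyl_elt v"
      and B: "B \<in> carrier SL2Zi" "unit_multiple B (word_mat v)" "psl_image y = ?Z #>\<^bsub>SL2Zi\<^esub> B"
      using N[OF y] by blast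
    have "psl_image (weyl_elt (u @ v)) = ?Z #>\<^bsub>SL2Zi\<^esub> (A \<otimes>\<^bsub>SL2Zi\<^esub> B)"
    proof (rule psl_image_eq)
      show "A \<otimes>\<^bsub>SL2Zi\<^esub> B \<in> carrier SL2Zi" using A B by simp
      have "unit_multiple (A ** B) (word_mat (u @ v))"
        using u A B by (simp add: word_mat_append conj_mat_pow_apply unit_multiple_mult)
      then show "unit_multiple (A \<otimes>\<^bsub>SL2Zi\<^esub> B) (word_mat (u @ v))" by (simp add: SL2Zi_def)
    qed (use u v in simp)
    also have "\<dots> = psl_image x \<otimes>\<^bsub>PSL2Zi\<^esub> psl_image y"
      using A B by (simp add: PSL2Zi_def FactGroup_def Z.rcos_sum)
    also have "weyl_elt (u @ v) = x \<otimes>\<^bsub>Wplus\<^esub> y"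
      using u v by (simp add: Wplus_mult W.elt_append)
    finally show "psl_image (x \<otimes>\<^bsub>Wplus\<lparr>carrier := ?N\<rparr>\<^esub> y) = psl_image x \<otimes>\<^bsub>PSL2Zi\<^esub> psl_image y"
      by simp
  qed
  have "inj_on psl_image ?N"
  proof (rule inj_onI)
    fix x y assume x: "x \<in> ?N" and y: "y \<in> ?N" and eq: "psl_image x = psl_image y"
    obtain u A where u: "u \<in> lists C2pp_nodes" "even (length u)" "even (count_list u 1)" "x = weyl_elt u"
      and A: "A \<in> carrier SL2Zi" "unit_multiple A (word_mat u)" "psl_image x = ?Z #>\<^bsub>SL2Zi\<^esub> A"
      using N[OF x] by blast
    obtain v where v: "v \<in> lists C2pp_nodes" "even (length v)" "even (count_list v 1)" "y = weyl_elt v"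
      using N[OF y] by blast
    have "A \<in> psl_image y" using A(3) eq by (simp add: centre_coset)
    then obtain v' where v': "v' \<in> lists C2pp_nodes" "weyl_elt v' = weyl_elt v"
      "unit_multiple A (word_mat v')"
      using v by (auto simp: psl_image_def)
    then have "unit_multiple (word_mat v') (word_mat v)"
      using weyl_elt_eq_imp_same_image v(1) by (simp add: same_image_def)
    then have "unit_multiple (word_mat u) (word_mat v)"
      using A(2) v'(3) by (blast intro: unit_multiple_trans unit_multiple_sym)
    then have "same_image u v" using u v by (simp add: same_image_def)
    then show "x = y" using weyl_elt_eq_iff u v by simp
  qed
  moreover have "psl_image ` ?N = carrier PSL2Zi"
  proof (intro equalityI subsetI)
    fix C assume "C \<in> psl_image ` ?N"
    then obtain x where "x \<in> ?N" "C = psl_image x" by blast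
    with N[OF this(1)] show "C \<in> carrier PSL2Zi" using in_PSL by auto
  next
    fix C assume "C \<in> carrier PSL2Zi"
    then obtain A where A: "A \<in> carrier SL2Zi" "C = ?Z #>\<^bsub>SL2Zi\<^esub> A"
      by (auto simp: PSL2Zi_def FactGroup_def RCOSETS_def)
    obtain n where "(cmod (A $ 2 $ 1))\<^sup>2 < real n" using reals_Archimedean2 by blast
    then have "realised A" by (rule SL2Zi_realised[OF A(1)])
    then obtain w where w: "w \<in> lists C2pp_nodes" "even (length w)" "even (count_list w 1)"
      "unit_multiple A (word_mat w)" unfolding realised_def by blast
    then have "psl_image (weyl_elt w) = C" using psl_image_eq A by simp
    moreover have "weyl_elt w \<in> ?N"
      using w odd_parity_weyl_elt[OF w(1)] unfolding Wplus_carrier by blast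
    ultimately show "C \<in> psl_image ` ?N" by blast
  qed
  ultimately show "bij_betw psl_image (carrier (Wplus\<lparr>carrier := ?N\<rparr>)) (carrier PSL2Zi)"
    by (simp add: bij_betw_def)
qed

theorem proposition6:
  shows "semidirect_by_2 (even_weyl_group C2pp_nodes C2pp_cartan) PSL2Zi"
proof -
  interpret Wplus: group Wplus by (rule Wplus_group)
  have k: "[-1, 1] \<in> lists C2pp_nodes" by (simp add: C2pp_nodes_def)
  show ?thesis
  proof (rule Wplus.semidirect_by_2I)
    show "odd_parity (x \<otimes>\<^bsub>Wplus\<^esub> y) \<longleftrightarrow> odd_parity x \<noteq> odd_parity y"
      if xy: "x \<in> carrier Wplus" "y \<in> carrier Wplus" for x y
    proof -
      obtain u v where uv: "u \<in> lists C2pp_nodes" "x = weyl_elt u" "v \<in> lists C2pp_nodes" "y = weyl_elt v"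
        using xy unfolding Wplus_carrier by blast
      then have "x \<otimes>\<^bsub>Wplus\<^esub> y = weyl_elt (u @ v)" by (simp add: Wplus_mult W.elt_append)
      then show ?thesis
        using uv odd_parity_weyl_elt[of "u @ v"] by (simp add: odd_parity_weyl_elt)
    qed
    show "weyl_elt [-1, 1] \<in> carrier Wplus"
      unfolding Wplus_carrier using k by (force simp del: word_prod_Cons)
    show "odd_parity (weyl_elt [-1, 1])"
      using odd_parity_weyl_elt[OF k] by (simp del: word_prod_Cons)
    have "same_image ([-1, 1] @ [-1, 1]) []"
      using same_image_braid[of "-1" 1 2]
      by (simp add: C2pp_exponent_enat C2pp_nodes_def doubleton_eq_iff numeral_eq_Suc)
    then have "weyl_elt ([-1, 1] @ [-1, 1]) = weyl_elt []"
      using weyl_elt_eq_iff[of "[-1, 1] @ [-1, 1]" "[]"] k by (simp only: append_in_lists_conv lists.Nil)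
    then show "weyl_elt [-1, 1] \<otimes>\<^bsub>Wplus\<^esub> weyl_elt [-1, 1] = \<one>\<^bsub>Wplus\<^esub>"
      using W.elt_append[OF k k] by (simp add: Wplus_mult even_weyl_group_def del: word_prod_Cons)
  qed (rule even_parity_iso_PSL2Zi)
qed

end
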